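(* Let $n\ge 1$. Define $$\Phi:\underbrace{\mathbb{S}^2\times\cdots\times\mathbb{S}^2}_{n}\to\mathbb{S}^{2n},\qquad ((\alpha_1,\tau_1),\dots,(\alpha_n,\tau_n))\mapsto (a_1,\dots,a_n,t),$$ $$a_i=\alpha_i\prod_{k=1}^n\tau_k^{M_{ik}},\qquad t=\prod_{i=1}^n\tau_i ,$$ where $M$ is the $n\times n$ matrix with $M_{ii}=0$, and $M_{ij}=1$, $M_{ji}=1/2$ for $i<j$. Equip $\mathbb{S}^2\times\cdots\times\mathbb{S}^2$ with the product of the standard Poisson structures. Then $\Phi$ is a Poisson map, and the coinduced brackets on $\mathbb{S}^{2n}$ read, for $i,k,\ell\in\{1,\dots,n\}$: $$\{a_k,a_\ell\}=a_ka_\ell\ \ (k<\ell),\qquad \{a_k,a_\ell^*\}=-3a_ka_\ell^*\ \ (k\neq\ell),$$ $$\{a_i,t\}=-2a_it,\qquad \{a_k,a_k^*\}=2t^2+2\sum_{\ell<k}a_\ell a_\ell^*-2a_ka_k^* .$$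
   Context: Here $\mathbb{S}^2=\{(\alpha,\tau)\in\mathbb{C}\times\mathbb{R}:\ |\alpha|^2=\tau(1-\tau)\}$ and $\mathbb{S}^{2n}=\{(a_1,\dots,a_n,t)\in\mathbb{C}^n\times\mathbb{R}:\ \sum_{i=1}^n|a_i|^2=t(1-t)\}$; $^*$ denotes complex conjugation of functions. Poisson brackets are taken on complex-valued functions: they are $\mathbb{C}$-bilinear, antisymmetric, satisfy the Leibniz and Jacobi identities, and obey the reality convention $\{f^*,g^*\}=-\{f,g\}^*$ (that is, the bracket is the imaginary unit times a real Poisson bracket). The product of standard Poisson structures on $\mathbb{S}^2\times\cdots\times\mathbb{S}^2$ is determined by $$\{\alpha_i,\tau_j\}=-2\delta_{ij}\alpha_i\tau_i,\qquad \{\alpha_i,\alpha_j^*\}=2\delta_{ij}(\tau_i^2-\alpha_i\alpha_i^* ),$$ the brackets of coordinates belonging to different factors being zero. The bracket is extended by the derivation rule to expressions involving $\tau_i^{1/2}$ (where $\tau_i>0$). That $\Phi$ is a Poisson map means that there is a Poisson bracket on $\mathbb{S}^{2n}$ (called the bracket coinduced by $\Phi$) with $\{f\circ\Phi,g\circ\Phi\}=\{f,g\}\circ\Phi$ for polynomial functions $f,g$ in $a_i,a_i^*,t$. *)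

theory Defs
  imports "HOL-Analysis.Analysis"
begin

text \<open>
  A complex-valued function on a set \<open>X\<close> of points is represented by a total function of which only
  the values on \<open>X\<close> matter.  Accordingly \<open>poly_funs\<close> is closed under changing values outside \<open>X\<close>,
  all laws of a Poisson bracket are required pointwise on \<open>X\<close>, and a bracket has to respect
  equality on \<open>X\<close>.
\<close>

inductive_set poly_funs :: "'p set \<Rightarrow> ('p \<Rightarrow> complex) set \<Rightarrow> ('p \<Rightarrow> complex) set"
  for X :: "'p set" and G :: "('p \<Rightarrow> complex) set" where
  gen: "f \<in> G \<Longrightarrow> f \<in> poly_funs X G"
| gen_cnj: "f \<in> G \<Longrightarrow> cnj \<circ> f \<in> poly_funs X G"
| const: "(\<lambda>_. c) \<in> poly_funs X G"
| add: "f \<in> poly_funs X G \<Longrightarrow> g \<in> poly_funs X G \<Longrightarrow> (\<lambda>x. f x + g x) \<in> poly_funs X G"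
| mult: "f \<in> poly_funs X G \<Longrightarrow> g \<in> poly_funs X G \<Longrightarrow> (\<lambda>x. f x * g x) \<in> poly_funs X G"
| cong: "f \<in> poly_funs X G \<Longrightarrow> (\<And>x. x \<in> X \<Longrightarrow> g x = f x) \<Longrightarrow> g \<in> poly_funs X G"

text \<open>
  Linearity and the Leibniz rule in the second argument follow from antisymmetry.
\<close>

locale poisson_bracket =
  fixes X :: "'p set"
    and A :: "('p \<Rightarrow> complex) set"
    and B :: "('p \<Rightarrow> complex) \<Rightarrow> ('p \<Rightarrow> complex) \<Rightarrow> ('p \<Rightarrow> complex)"
  assumes closed: "f \<in> A \<Longrightarrow> g \<in> A \<Longrightarrow> B f g \<in> A"
    and respects: "f \<in> A \<Longrightarrow> f' \<in> A \<Longrightarrow> g \<in> A \<Longrightarrow> (\<And>y. y \<in> X \<Longrightarrow> f y = f' y) \<Longrightarrow>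
      x \<in> X \<Longrightarrow> B f g x = B f' g x"
    and antisym: "f \<in> A \<Longrightarrow> g \<in> A \<Longrightarrow> x \<in> X \<Longrightarrow> B f g x = - B g f x"
    and additive: "f \<in> A \<Longrightarrow> g \<in> A \<Longrightarrow> h \<in> A \<Longrightarrow> x \<in> X \<Longrightarrow>
      B (\<lambda>y. f y + g y) h x = B f h x + B g h x"
    and scale: "f \<in> A \<Longrightarrow> g \<in> A \<Longrightarrow> x \<in> X \<Longrightarrow> B (\<lambda>y. c * f y) g x = c * B f g x"
    and leibniz: "f \<in> A \<Longrightarrow> g \<in> A \<Longrightarrow> h \<in> A \<Longrightarrow> x \<in> X \<Longrightarrow>
      B (\<lambda>y. f y * g y) h x = f x * B g h x + B f h x * g x"
    and jacobi: "f \<in> A \<Longrightarrow> g \<in> A \<Longrightarrow> h \<in> A \<Longrightarrow> x \<in> X \<Longrightarrow>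
      B f (B g h) x + B g (B h f) x + B h (B f g) x = 0"
    and reality: "f \<in> A \<Longrightarrow> g \<in> A \<Longrightarrow> x \<in> X \<Longrightarrow>
      B (cnj \<circ> f) (cnj \<circ> g) x = - cnj (B f g x)"

text \<open>
  The indices \<open>1, \<dots>, n\<close> are the elements of a finite linearly ordered type.
\<close>

type_synonym 'n S2_prod_space = "(complex \<times> real, 'n) vec"
type_synonym 'n S2n_space = "(complex, 'n) vec \<times> real"

definition S2 :: "(complex \<times> real) set" where
  "S2 = {(\<alpha>, \<tau>). (cmod \<alpha>)\<^sup>2 = \<tau> * (1 - \<tau>)}"

definition S2_prod :: "('n::finite) S2_prod_space set" where
  "S2_prod = {p. \<forall>i. p $ i \<in> S2}"

definition S2_prod_pos :: "('n::finite) S2_prod_space set" where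
  "S2_prod_pos = {p \<in> S2_prod. \<forall>i. snd (p $ i) > 0}"

definition S2n :: "('n::finite) S2n_space set" where
  "S2n = {(a, t). (\<Sum>i\<in>UNIV. (cmod (a $ i))\<^sup>2) = t * (1 - t)}"

definition alpha :: "'n::finite \<Rightarrow> 'n S2_prod_space \<Rightarrow> complex" where
  "alpha i p = fst (p $ i)"

definition tau :: "'n::finite \<Rightarrow> 'n S2_prod_space \<Rightarrow> complex" where
  "tau i p = of_real (snd (p $ i))"

definition sqrt_tau :: "'n::finite \<Rightarrow> 'n S2_prod_space \<Rightarrow> complex" where
  "sqrt_tau i p = of_real (sqrt (snd (p $ i)))"

definition coord_a :: "'n::finite \<Rightarrow> 'n S2n_space \<Rightarrow> complex" where
  "coord_a i x = fst x $ i"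

definition coord_t :: "('n::finite) S2n_space \<Rightarrow> complex" where
  "coord_t x = of_real (snd x)"

text \<open>
  Since \<open>\<tau> = \<tau>\<^sup>1\<^sup>/\<^sup>2 \<cdot> \<tau>\<^sup>1\<^sup>/\<^sup>2\<close>, the Leibniz rule determines the brackets with \<open>\<tau>\<^sup>1\<^sup>/\<^sup>2\<close> from those
  with \<open>\<tau>\<close> at all points with \<open>\<tau> > 0\<close>; this is why the bracket is taken on \<open>S2_prod_pos\<close>, which
  is dense in \<open>S2_prod\<close>.
\<close>

definition half_poly_S2_prod :: "(('n::finite) S2_prod_space \<Rightarrow> complex) set" where
  "half_poly_S2_prod = poly_funs S2_prod_pos (range alpha \<union> range tau \<union> range sqrt_tau)"

definition poly_S2n :: "(('n::finite) S2n_space \<Rightarrow> complex) set" where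
  "poly_S2n = poly_funs S2n (range coord_a \<union> {coord_t})"

locale standard_product_bracket =
  poisson_bracket S2_prod_pos half_poly_S2_prod B
  for B :: "(('n::finite) S2_prod_space \<Rightarrow> complex) \<Rightarrow> ('n S2_prod_space \<Rightarrow> complex) \<Rightarrow>
    ('n S2_prod_space \<Rightarrow> complex)" +
  assumes alpha_tau: "p \<in> S2_prod_pos \<Longrightarrow>
      B (alpha i) (tau j) p = (if i = j then - 2 * alpha i p * tau i p else 0)"
    and alpha_cnj_alpha: "p \<in> S2_prod_pos \<Longrightarrow>
      B (alpha i) (cnj \<circ> alpha j) p =
        (if i = j then 2 * ((tau i p)\<^sup>2 - alpha i p * cnj (alpha i p)) else 0)"
    and alpha_alpha: "p \<in> S2_prod_pos \<Longrightarrow> i \<noteq> j \<Longrightarrow> B (alpha i) (alpha j) p = 0"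
    and tau_tau: "p \<in> S2_prod_pos \<Longrightarrow> i \<noteq> j \<Longrightarrow> B (tau i) (tau j) p = 0"

definition M :: "real ^ 'n::{finite,linorder} ^ 'n::{finite,linorder}" where
  "M = (\<chi> i j. if i = j then 0 else if i < j then 1 else 1 / 2)"

text \<open>
  The library has \<open>0 powr 0 = 0\<close> instead of \<open>1\<close>.  This affects only the factor \<open>k = i\<close> at points
  with \<open>\<tau>\<^sub>i = 0\<close>, where \<open>\<alpha>\<^sub>i = 0\<close> anyway.
\<close>

definition Phi :: "('n::{finite,linorder}) S2_prod_space \<Rightarrow> 'n S2n_space" where
  "Phi p = ((\<chi> i. fst (p $ i) * of_real (\<Prod>k\<in>UNIV. snd (p $ k) powr (M $ i $ k))),
            \<Prod>i\<in>UNIV. snd (p $ i))"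

definition coinduced_bracket ::
  "('n S2_prod_space \<Rightarrow> 'n S2n_space) \<Rightarrow>
   ((('n::finite) S2_prod_space \<Rightarrow> complex) \<Rightarrow> ('n S2_prod_space \<Rightarrow> complex) \<Rightarrow>
    ('n S2_prod_space \<Rightarrow> complex)) \<Rightarrow>
   (('n S2n_space \<Rightarrow> complex) \<Rightarrow> ('n S2n_space \<Rightarrow> complex) \<Rightarrow>
    ('n S2n_space \<Rightarrow> complex)) \<Rightarrow> bool" where
  "coinduced_bracket F B C \<longleftrightarrow>
     poisson_bracket S2n poly_S2n C \<and>
     (\<forall>f\<in>poly_S2n. \<forall>g\<in>poly_S2n.
        f \<circ> F \<in> half_poly_S2_prod \<and> g \<circ> F \<in> half_poly_S2_prod \<and>
        (\<forall>p\<in>S2_prod_pos. B (f \<circ> F) (g \<circ> F) p = C f g (F p)))"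

definition poisson_map ::
  "('n S2_prod_space \<Rightarrow> 'n S2n_space) \<Rightarrow>
   ((('n::finite) S2_prod_space \<Rightarrow> complex) \<Rightarrow> ('n S2_prod_space \<Rightarrow> complex) \<Rightarrow>
    ('n S2_prod_space \<Rightarrow> complex)) \<Rightarrow> bool" where
  "poisson_map F B \<longleftrightarrow> F ` S2_prod \<subseteq> S2n \<and> (\<exists>C. coinduced_bracket F B C)"

subsection \<open>Existence of the standard product bracket\<close>

text \<open>
  In the coordinates \<open>z\<^sub>i = \<alpha>\<^sub>i / \<tau>\<^sub>i\<close>, which identify the points with all \<open>\<tau>\<^sub>i > 0\<close> with a complex
  vector space, the standard bracket has the only non-zero coordinate brackets
  \<open>{z\<^sub>i, z\<^sub>i\<^sup>*} = 2 (1 + |z\<^sub>i|\<^sup>2)\<close>.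
\<close>

lemma poly_funs_sum:
  assumes "finite I" "\<And>i. i \<in> I \<Longrightarrow> f i \<in> poly_funs X G"
  shows "(\<lambda>x. \<Sum>i\<in>I. f i x) \<in> poly_funs X G"
  using assms by (induction I rule: finite_induct) (auto intro: poly_funs.const poly_funs.add)

lemma poly_funs_minus:
  assumes "f \<in> poly_funs X G" shows "(\<lambda>x. - f x) \<in> poly_funs X G"
  using poly_funs.mult[OF poly_funs.const[of "-1"] assms] by simp

lemma poly_funs_diff:
  assumes "f \<in> poly_funs X G" "g \<in> poly_funs X G" shows "(\<lambda>x. f x - g x) \<in> poly_funs X G"
  using poly_funs.add[OF assms(1) poly_funs_minus[OF assms(2)]] by simp

lemma poly_funs_power:
  assumes "f \<in> poly_funs X G" shows "(\<lambda>x. f x ^ n) \<in> poly_funs X G"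
  by (induction n) (use assms in \<open>auto intro: poly_funs.const poly_funs.mult\<close>)

lemma poly_funs_cnj:
  assumes "f \<in> poly_funs X G" shows "cnj \<circ> f \<in> poly_funs X G"
  using assms
proof induction
  case (gen f) then show ?case by (rule poly_funs.gen_cnj)
next
  case (gen_cnj f) then show ?case using poly_funs.gen by (simp add: o_def)
next
  case (const c) then show ?case using poly_funs.const by (simp add: o_def)
next
  case (add f g) then show ?case using poly_funs.add by (fastforce simp add: o_def)
next
  case (mult f g) then show ?case using poly_funs.mult by (fastforce simp add: o_def)
next
  case (cong f g) then show ?case by (auto intro: poly_funs.cong)
qed

definition wir :: "bool \<Rightarrow> 'n::finite \<Rightarrow> (complex ^ 'n \<Rightarrow> complex) \<Rightarrow> complex ^ 'n \<Rightarrow> complex" where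
  "wir b i f z = (frechet_derivative f (at z) (axis i 1)
     + (if b then \<i> else - \<i>) * frechet_derivative f (at z) (axis i \<i>)) / 2"

lemma wir_eqI:
  assumes "(f has_derivative f') (at z)"
  shows "wir b i f z = (f' (axis i 1) + (if b then \<i> else - \<i>) * f' (axis i \<i>)) / 2"
  using frechet_derivative_at[OF assms] by (simp add: wir_def)

definition chart_z :: "'n::finite \<Rightarrow> complex ^ 'n \<Rightarrow> complex" where
  "chart_z i z = z $ i"

definition chart_r :: "'n::finite \<Rightarrow> complex ^ 'n \<Rightarrow> complex" where
  "chart_r i z = of_real (inverse (sqrt (1 + (Re (z $ i))\<^sup>2 + (Im (z $ i))\<^sup>2)))"

definition chart_funs :: "(complex ^ 'n::finite \<Rightarrow> complex) set" where
  "chart_funs = poly_funs UNIV (range chart_z \<union> range chart_r)"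

lemma cnj_chart_r: "cnj \<circ> chart_r i = chart_r i"
  by (auto simp: chart_r_def)

lemma chart_r_sq: "chart_r i z * chart_r i z * (1 + z $ i * cnj (z $ i)) = 1"
proof -
  have p: "1 + (Re (z $ i))\<^sup>2 + (Im (z $ i))\<^sup>2 > 0" by (smt (verit) zero_le_power2)
  have *: "chart_r i z * chart_r i z = of_real (inverse (1 + (Re (z $ i))\<^sup>2 + (Im (z $ i))\<^sup>2))"
    using p unfolding chart_r_def of_real_mult[symmetric]
    by (simp add: field_simps flip: power2_eq_square)
  have **: "1 + z $ i * cnj (z $ i) = of_real (1 + (Re (z $ i))\<^sup>2 + (Im (z $ i))\<^sup>2)"
    by (simp add: complex_mult_cnj)
  show ?thesis unfolding * ** of_real_mult[symmetric] using p by simp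
qed

lemma chart_z_deriv: "(chart_z i has_derivative (\<lambda>h. h $ i)) (at z)"
proof -
  have "bounded_linear (\<lambda>h :: complex ^ 'a. h $ i)" by (rule bounded_linear_vec_nth)
  then show ?thesis unfolding chart_z_def[abs_def]
    by (rule bounded_linear_imp_has_derivative)
qed

lemma chart_r_deriv:
  "(chart_r i has_derivative (\<lambda>h. - (chart_r i z ^ 3) * of_real (Re (z $ i) * Re (h $ i) + Im (z $ i) * Im (h $ i)))) (at z)"
proof -
  have p: "1 + (Re (z $ i))\<^sup>2 + (Im (z $ i))\<^sup>2 > 0" by (smt (verit) zero_le_power2)
  have l: "((\<lambda>z. z $ i) has_derivative (\<lambda>h. h $ i)) (at z)"
    using chart_z_deriv unfolding chart_z_def[abs_def] .
  define q where "q z = 1 + (Re (z $ i))\<^sup>2 + (Im (z $ i))\<^sup>2" for z :: "complex ^ 'a"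
  have q: "(q has_derivative (\<lambda>h. 2 * (Re (z $ i) * Re (h $ i) + Im (z $ i) * Im (h $ i)))) (at z)"
    unfolding q_def[abs_def] by (auto intro!: derivative_eq_intros l simp: algebra_simps)
  have v: "((\<lambda>u. inverse (sqrt u)) has_real_derivative - (inverse (sqrt (q z)) ^ 3) / 2) (at (q z))"
    using p unfolding q_def[symmetric]
    by (auto intro!: derivative_eq_intros simp: field_simps power3_eq_cube power2_eq_square)
  have "((\<lambda>z. of_real (inverse (sqrt (q z)))) has_derivative
      (\<lambda>h. complex_of_real ((2 * (Re (z $ i) * Re (h $ i) + Im (z $ i) * Im (h $ i))) *
        (- (inverse (sqrt (q z)) ^ 3) / 2)))) (at z)"
    by (rule has_derivative_of_real[OF DERIV_compose_FDERIV[OF v q]])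
  moreover have "(2 * s) * (- (inverse (sqrt (q z)) ^ 3) / 2) = - (inverse (sqrt (q z)) ^ 3) * s" for s
    by simp
  ultimately show ?thesis
    unfolding chart_r_def[abs_def] q_def[symmetric]
    by (simp only: of_real_mult of_real_minus of_real_power)
qed

lemma chart_funs_differentiable: "f \<in> chart_funs \<Longrightarrow> f differentiable (at z)"
  unfolding chart_funs_def
proof (induction arbitrary: z rule: poly_funs.induct)
  case (gen f) then show ?case using differentiableI[OF chart_z_deriv] differentiableI[OF chart_r_deriv] by blast
next
  case (gen_cnj f)
  have "f differentiable (at z)" using gen_cnj differentiableI[OF chart_z_deriv] differentiableI[OF chart_r_deriv] by blast
  then show ?case
    by (auto simp: differentiable_def o_def intro: bounded_linear.has_derivative[OF bounded_linear_cnj])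
next
  case (cong f g) then have "g = f" by auto
  with cong show ?case by simp
qed auto

lemma wir_const: "wir b i (\<lambda>_. c) z = 0"
  by (subst wir_eqI[OF has_derivative_const]) simp

lemma wir_add:
  assumes "f \<in> chart_funs" "g \<in> chart_funs"
  shows "wir b i (\<lambda>x. f x + g x) z = wir b i f z + wir b i g z"
proof -
  note d = assms[THEN chart_funs_differentiable[of _ z], unfolded frechet_derivative_works]
  show ?thesis by (subst wir_eqI[OF has_derivative_add[OF d]]) (simp add: wir_def field_simps)
qed

lemma wir_mult:
  assumes "f \<in> chart_funs" "g \<in> chart_funs"
  shows "wir b i (\<lambda>x. f x * g x) z = f z * wir b i g z + wir b i f z * g z"
proof -
  note d = assms[THEN chart_funs_differentiable[of _ z], unfolded frechet_derivative_works]
  show ?thesis by (subst wir_eqI[OF has_derivative_mult[OF d]]) (simp add: wir_def field_simps)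
qed

lemma wir_cnj:
  assumes "f \<in> chart_funs"
  shows "wir b i (cnj \<circ> f) z = cnj (wir (\<not> b) i f z)"
proof -
  note d = assms[THEN chart_funs_differentiable[of _ z], unfolded frechet_derivative_works]
  show ?thesis unfolding o_def
    by (subst wir_eqI[OF bounded_linear.has_derivative[OF bounded_linear_cnj d]]) (simp add: wir_def field_simps)
qed

lemma chart_funs_gen [simp]:
  "chart_z i \<in> chart_funs" "chart_r i \<in> chart_funs"
  "(\<lambda>_. c) \<in> chart_funs"
  by (auto simp: chart_funs_def intro: poly_funs.intros)

lemmas chart_funs_intros =
  poly_funs.add[where X = UNIV and G = "range chart_z \<union> range chart_r", folded chart_funs_def]
  poly_funs.mult[where X = UNIV and G = "range chart_z \<union> range chart_r", folded chart_funs_def]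
  poly_funs_diff[where X = UNIV and G = "range chart_z \<union> range chart_r", folded chart_funs_def]
  poly_funs_minus[where X = UNIV and G = "range chart_z \<union> range chart_r", folded chart_funs_def]
  poly_funs_power[where X = UNIV and G = "range chart_z \<union> range chart_r", folded chart_funs_def]
  poly_funs_sum[where X = UNIV and G = "range chart_z \<union> range chart_r", folded chart_funs_def]
  poly_funs_cnj[where X = UNIV and G = "range chart_z \<union> range chart_r", folded chart_funs_def]

lemma wir_z: "wir b i (chart_z j) z = (if i = j \<and> \<not> b then 1 else 0)"
  by (subst wir_eqI[OF chart_z_deriv]) (auto simp: axis_def)

lemma wir_r: "wir b i (chart_r j) z =
    (if i = j then - (1/2) * (if b then chart_z i z else cnj (chart_z i z)) * chart_r i z ^ 3 else 0)"
  by (subst wir_eqI[OF chart_r_deriv]) (auto simp: axis_def chart_z_def complex_eq_iff field_simps)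

lemma wir_cong: "f = g \<Longrightarrow> wir b i f z = wir b i g z" by simp

lemma wir_uminus: "f \<in> chart_funs \<Longrightarrow> wir b i (\<lambda>x. - f x) z = - wir b i f z"
  using wir_mult[OF chart_funs_gen(3)[of "-1"], of f b i z] by (simp add: wir_const)

lemma wir_diff: "f \<in> chart_funs \<Longrightarrow> g \<in> chart_funs \<Longrightarrow>
    wir b i (\<lambda>x. f x - g x) z = wir b i f z - wir b i g z"
  using wir_add[of f "\<lambda>x. - g x" b i z] wir_uminus[of g b i z] chart_funs_intros(4)[of g] by simp

lemma wir_sum:
  "finite I \<Longrightarrow> (\<And>k. k \<in> I \<Longrightarrow> f k \<in> chart_funs) \<Longrightarrow>
    wir b i (\<lambda>x. \<Sum>k\<in>I. f k x) z = (\<Sum>k\<in>I. wir b i (f k) z)"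
proof (induction I rule: finite_induct)
  case (insert k I)
  have "(\<lambda>x. \<Sum>k\<in>I. f k x) \<in> chart_funs" using insert by (intro chart_funs_intros) auto
  then show ?case using insert by (simp add: wir_add)
qed (simp add: wir_const)

lemma wir_power:
  assumes "f \<in> chart_funs"
  shows "wir b i (\<lambda>x. f x ^ n) z = of_nat n * f z ^ (n - 1) * wir b i f z"
proof (induction n)
  case (Suc n)
  then show ?case using assms chart_funs_intros(5)[OF assms, of n]
    by (cases n) (simp_all add: wir_mult field_simps)
qed (simp add: wir_const)

lemma cnj_chart_z: "(cnj \<circ> chart_z j) z = cnj (chart_z j z)" by simp

lemma wir_cnj_z: "wir b i (cnj \<circ> chart_z j) z = (if i = j \<and> b then 1 else 0)"
  by (auto simp: wir_cnj wir_z)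

lemma wir_closed:
  assumes "f \<in> chart_funs" shows "wir b i f \<in> chart_funs"
proof -
  have z: "wir b i (chart_z j) \<in> chart_funs" for j
  proof -
    have "wir b i (chart_z j) = (\<lambda>z. if i = j \<and> \<not> b then 1 else 0)" by (rule ext) (rule wir_z)
    then show ?thesis by simp
  qed
  have cz: "wir b i (cnj \<circ> chart_z j) \<in> chart_funs" for j
  proof -
    have "wir b i (cnj \<circ> chart_z j) = (\<lambda>z. if i = j \<and> b then 1 else 0)" by (rule ext) (rule wir_cnj_z)
    then show ?thesis by simp
  qed
  have r: "wir b i (chart_r j) \<in> chart_funs" for j
  proof -
    have "wir b i (chart_r j) = (\<lambda>z. (if i = j then - (1/2) else 0) *
       (if b then chart_z i else cnj \<circ> chart_z i) z * chart_r i z ^ 3)"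
      by (rule ext) (simp add: wir_r)
    also have "\<dots> \<in> chart_funs"
      by (intro chart_funs_intros chart_funs_gen) (auto intro!: chart_funs_intros)
    finally show ?thesis .
  qed
  have c: "wir b i (\<lambda>_. c) \<in> chart_funs" for c
  proof -
    have "wir b i (\<lambda>_. c) = (\<lambda>z. 0)" by (rule ext) (rule wir_const)
    then show ?thesis by simp
  qed
  show ?thesis
    using assms unfolding chart_funs_def
  proof (induction rule: poly_funs.induct)
    case (gen f) then show ?case using z r unfolding chart_funs_def by blast
  next
    case (gen_cnj f) then show ?case using cz r unfolding chart_funs_def by (metis Un_iff cnj_chart_r imageE)
  next
    case (const c) then show ?case using c unfolding chart_funs_def by blast
  next
    case (add f g)
    then have "wir b i (\<lambda>x. f x + g x) = (\<lambda>x. wir b i f x + wir b i g x)"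
      by (intro ext wir_add) (simp_all add: chart_funs_def)
    with add show ?case by (simp add: poly_funs.add)
  next
    case (mult f g)
    then have "wir b i (\<lambda>x. f x * g x) = (\<lambda>x. f x * wir b i g x + wir b i f x * g x)"
      by (intro ext wir_mult) (simp_all add: chart_funs_def)
    with mult show ?case by (simp add: poly_funs.add poly_funs.mult)
  next
    case (cong f g)
    then have "g = f" by (intro ext) simp
    with cong show ?case by simp
  qed
qed

lemma wir_commute:
  assumes "f \<in> chart_funs" shows "wir b i (wir c j f) = wir c j (wir b i f)"
  using assms unfolding chart_funs_def
proof (induction rule: poly_funs.induct)
  have z: "wir b i (wir c j (chart_z k)) z = 0" for b i c j k z
  proof -
    have "wir c j (chart_z k) = (\<lambda>z. if j = k \<and> \<not> c then 1 else 0)" by (rule ext) (rule wir_z)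
    then show ?thesis using wir_const by auto
  qed
  have cz: "wir b i (wir c j (cnj \<circ> chart_z k)) z = 0" for b i c j k z
  proof -
    have "wir c j (cnj \<circ> chart_z k) = (\<lambda>z. if j = k \<and> c then 1 else 0)" by (rule ext) (rule wir_cnj_z)
    then show ?thesis using wir_const by auto
  qed
  have r: "wir b i (wir c j (chart_r k)) = wir c j (wir b i (chart_r k))" for k
  proof -
    define y where "y c j = (if c then chart_z j else cnj \<circ> chart_z j)" for c and j :: 'a
    have y: "y c j \<in> chart_funs" for c j
      by (cases c) (auto intro: chart_funs_intros simp: y_def simp del: o_apply)
    have dy: "wir b i (y c j) z = (if i = j \<and> b \<noteq> c then 1 else 0)" for b i c j z
      by (cases c) (auto simp: y_def wir_z wir_cnj_z simp del: o_apply)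
    have dr: "wir c j (chart_r k) z = (if j = k then - (1/2) else 0) * (y c j z * chart_r j z ^ 3)" for c j z
      by (simp add: wir_r y_def)
    have e: "wir c j (chart_r k) = (\<lambda>z. (if j = k then - (1/2) else 0) * (y c j z * chart_r j z ^ 3))" for c j
      by (rule ext) (rule dr)
    have r3: "(\<lambda>z. chart_r j z ^ 3) \<in> chart_funs" for j :: 'a
      by (intro chart_funs_intros chart_funs_gen)
    have "wir b i (wir c j (chart_r k)) z = (if j = k then - (1/2) else 0) *
       (y c j z * (3 * chart_r j z ^ 2 * wir b i (chart_r j) z)
         + (if i = j \<and> b \<noteq> c then 1 else 0) * chart_r j z ^ 3)" for b i c j z
      unfolding e
      by (subst wir_mult[OF chart_funs_gen(3) chart_funs_intros(2)[OF y r3]], subst wir_mult[OF y r3],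
          subst wir_power[OF chart_funs_gen(2)]) (simp add: wir_const dy)
    then show ?thesis by (intro ext) (auto simp: wir_r y_def)
  qed
  {
    case (gen f)
    have "wir b i (wir c j (chart_z k)) = wir c j (wir b i (chart_z k))" for k
      by (rule ext) (simp add: z)
    with gen r show ?case by blast
  next
    case (gen_cnj f)
    have "wir b i (wir c j (cnj \<circ> chart_z k)) = wir c j (wir b i (cnj \<circ> chart_z k))" for k
      by (rule ext) (simp add: cz del: o_apply)
    with gen_cnj r show ?case by (metis Un_iff cnj_chart_r imageE)
  }
next
  case (const c)
  have "wir b i (\<lambda>_. c) = (\<lambda>z. 0)" for b and i :: 'a by (rule ext) (rule wir_const)
  then show ?case by (simp add: wir_const fun_eq_iff)
next
  case (add f g)
  then have *: "f \<in> chart_funs" "g \<in> chart_funs" by (simp_all add: chart_funs_def)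
  have "wir b i (\<lambda>x. f x + g x) = (\<lambda>x. wir b i f x + wir b i g x)" for b i
    using * by (intro ext) (simp add: wir_add)
  with add * show ?case by (simp add: fun_eq_iff wir_add wir_closed)
next
  case (mult f g)
  then have *: "f \<in> chart_funs" "g \<in> chart_funs" by (simp_all add: chart_funs_def)
  have e: "wir b i (\<lambda>x. f x * g x) = (\<lambda>x. f x * wir b i g x + wir b i f x * g x)" for b i
    using * by (intro ext) (simp add: wir_mult)
  have "wir b i (wir c j (\<lambda>x. f x * g x)) z = wir c j (wir b i (\<lambda>x. f x * g x)) z" for z
    unfolding e using * mult
    by (simp add: wir_add wir_mult wir_closed chart_funs_intros algebra_simps)
  then show ?case by blast
next
  case (cong f g)
  then have "g = f" by auto
  with cong show ?case by simp
qed

definition chart_bracket :: "(complex ^ 'n::finite \<Rightarrow> complex) \<Rightarrow> (complex ^ 'n \<Rightarrow> complex) \<Rightarrow>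
    complex ^ 'n \<Rightarrow> complex" where
  "chart_bracket f g z = (\<Sum>i\<in>UNIV. 2 * (1 + chart_z i z * (cnj \<circ> chart_z i) z) *
     (wir False i f z * wir True i g z - wir True i f z * wir False i g z))"

lemma chart_bracket_closed: "f \<in> chart_funs \<Longrightarrow> g \<in> chart_funs \<Longrightarrow> chart_bracket f g \<in> chart_funs"
  unfolding chart_bracket_def[abs_def]
  by (intro chart_funs_intros chart_funs_gen wir_closed) auto

lemma jacobi_same_index:
  fixes fd00 fd01 fd11 fi0 fi1 gd00 gd01 gd11 gi0 gi1 hd00 hd01 hd11 hi0 hi1 w w0 w1 :: complex
  shows "
    w * (fi0 * (w1 * (gi0 * hi1 - gi1 * hi0) + w * (gd01 * hi1 + gi0 * hd11 - gd11 * hi0 -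
    gi1 * hd01)) - fi1 * (w0 * (gi0 * hi1 - gi1 * hi0) + w * (gd00 * hi1 + gi0 * hd01 -
    gd01 * hi0 - gi1 * hd00))) + w * (gi0 * (w1 * (hi0 * fi1 - hi1 * fi0) + w * (hd01 *
    fi1 + hi0 * fd11 - hd11 * fi0 - hi1 * fd01)) - gi1 * (w0 * (hi0 * fi1 - hi1 * fi0) + w
    * (hd00 * fi1 + hi0 * fd01 - hd01 * fi0 - hi1 * fd00))) + w * (hi0 * (w1 * (fi0 * gi1
    - fi1 * gi0) + w * (fd01 * gi1 + fi0 * gd11 - fd11 * gi0 - fi1 * gd01)) - hi1 * (w0 *
    (fi0 * gi1 - fi1 * gi0) + w * (fd00 * gi1 + fi0 * gd01 - fd01 * gi0 - fi1 * gd00))) = 0"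
  by algebra

lemma jacobi_two_indices:
  fixes fd00 fd01 fd10 fd11 fi0 fi1 fj0 fj1 gd00 gd01 gd10 gd11 gi0 gi1 gj0 gj1 hd00 hd01 hd10 hd11 hi0 hi1 hj0 hj1 wi wj :: complex
  shows "
    (wi * (fi0 * (0 * (gj0 * hj1 - gj1 * hj0) + wj * (gd10 * hj1 + gj0 * hd11 - gd11 * hj0
    - gj1 * hd10)) - fi1 * (0 * (gj0 * hj1 - gj1 * hj0) + wj * (gd00 * hj1 + gj0 * hd01 -
    gd01 * hj0 - gj1 * hd00))) + wi * (gi0 * (0 * (hj0 * fj1 - hj1 * fj0) + wj * (hd10 *
    fj1 + hj0 * fd11 - hd11 * fj0 - hj1 * fd10)) - gi1 * (0 * (hj0 * fj1 - hj1 * fj0) + wj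
    * (hd00 * fj1 + hj0 * fd01 - hd01 * fj0 - hj1 * fd00))) + wi * (hi0 * (0 * (fj0 * gj1
    - fj1 * gj0) + wj * (fd10 * gj1 + fj0 * gd11 - fd11 * gj0 - fj1 * gd10)) - hi1 * (0 *
    (fj0 * gj1 - fj1 * gj0) + wj * (fd00 * gj1 + fj0 * gd01 - fd01 * gj0 - fj1 * gd00))))
    + (wj * (fj0 * (0 * (gi0 * hi1 - gi1 * hi0) + wi * (gd01 * hi1 + gi0 * hd11 - gd11 *
    hi0 - gi1 * hd01)) - fj1 * (0 * (gi0 * hi1 - gi1 * hi0) + wi * (gd00 * hi1 + gi0 *
    hd10 - gd10 * hi0 - gi1 * hd00))) + wj * (gj0 * (0 * (hi0 * fi1 - hi1 * fi0) + wi *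
    (hd01 * fi1 + hi0 * fd11 - hd11 * fi0 - hi1 * fd01)) - gj1 * (0 * (hi0 * fi1 - hi1 *
    fi0) + wi * (hd00 * fi1 + hi0 * fd10 - hd10 * fi0 - hi1 * fd00))) + wj * (hj0 * (0 *
    (fi0 * gi1 - fi1 * gi0) + wi * (fd01 * gi1 + fi0 * gd11 - fd11 * gi0 - fi1 * gd01)) -
    hj1 * (0 * (fi0 * gi1 - fi1 * gi0) + wi * (fd00 * gi1 + fi0 * gd10 - fd10 * gi0 - fi1
    * gd00)))) = 0"
  by algebra

lemma chart_bracket_jacobi:
  assumes f: "f \<in> chart_funs" and g: "g \<in> chart_funs" and h: "h \<in> chart_funs"
  shows "chart_bracket f (chart_bracket g h) z + chart_bracket g (chart_bracket h f) z
    + chart_bracket h (chart_bracket f g) z = 0"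
proof -
  define w :: "'a \<Rightarrow> complex ^ 'a \<Rightarrow> complex" where
    "w i z = 2 * (1 + chart_z i z * (cnj \<circ> chart_z i) z)" for i z
  have w: "w i \<in> chart_funs" for i
    unfolding w_def[abs_def] by (intro chart_funs_intros chart_funs_gen)
  have dw: "wir b i (w j) z = 0" if "i \<noteq> j" for b i j
    unfolding w_def[abs_def] using that
    by (subst wir_mult) (auto intro!: chart_funs_intros simp: wir_add wir_mult wir_const wir_z wir_cnj_z chart_funs_intros simp del: o_apply)
  define P where "P i f g x = w i x * (wir False i f x * wir True i g x - wir True i f x * wir False i g x)" for i f g x
  have P: "P i f g \<in> chart_funs" if "f \<in> chart_funs" "g \<in> chart_funs" for i f g
    unfolding P_def[abs_def] by (intro chart_funs_intros w wir_closed that)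
  have B: "chart_bracket f g = (\<lambda>x. \<Sum>i\<in>UNIV. P i f g x)" for f g
    unfolding chart_bracket_def[abs_def] P_def w_def by simp
  have dP: "wir b k (P i f g) z = wir b k (w i) z * (wir False i f z * wir True i g z - wir True i f z * wir False i g z)
     + w i z * (wir b k (wir False i f) z * wir True i g z + wir False i f z * wir b k (wir True i g) z
       - wir b k (wir True i f) z * wir False i g z - wir True i f z * wir b k (wir False i g) z)"
    if "f \<in> chart_funs" "g \<in> chart_funs" for b k i f g
    unfolding P_def[abs_def] using that w
    by (simp add: wir_mult wir_diff wir_closed chart_funs_intros algebra_simps)
  have PP: "chart_bracket f (chart_bracket g h) z = (\<Sum>i\<in>UNIV. \<Sum>j\<in>UNIV. P i f (P j g h) z)"
    if "f \<in> chart_funs" "g \<in> chart_funs" "h \<in> chart_funs" for f g h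
    unfolding B using that P
    by (simp add: P_def[of _ _ "\<lambda>x. \<Sum>i\<in>UNIV. P i g h x"] P_def[of _ _ "P _ g h"] wir_sum
        sum_distrib_left sum_distrib_right sum_subtractf algebra_simps)
  define S where "S i j = P i f (P j g h) z + P i g (P j h f) z + P i h (P j f g) z" for i j
  have comm: "wir b i (wir c j f) z = wir c j (wir b i f) z" if "f \<in> chart_funs" for b c i j f
    using wir_commute[OF that] by metis
  have S: "S i j + S j i = 0" for i j
  proof (cases "i = j")
    case True
    have "S j j = 0"
      unfolding S_def P_def[of _ _ "P _ _ _"] dP[OF f g] dP[OF g h] dP[OF h f]
        comm[OF f, of True j False j] comm[OF g, of True j False j] comm[OF h, of True j False j]
      by (rule jacobi_same_index)
    then show ?thesis using True by simp
  next
    case False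
    show ?thesis
      unfolding S_def P_def[of _ _ "P _ _ _"] dP[OF f g] dP[OF g h] dP[OF h f]
        comm[OF f, of _ j _ i] comm[OF g, of _ j _ i] comm[OF h, of _ j _ i]
        dw[OF False] dw[OF False[symmetric]]
      by (rule jacobi_two_indices)
  qed
  have "(\<Sum>i\<in>UNIV. \<Sum>j\<in>UNIV. S i j) + (\<Sum>i\<in>UNIV. \<Sum>j\<in>UNIV. S j i) = 0"
    using S by (simp flip: sum.distrib)
  moreover have "(\<Sum>i\<in>UNIV. \<Sum>j\<in>UNIV. S j i) = (\<Sum>i\<in>UNIV. \<Sum>j\<in>UNIV. S i j)"
    by (rule sum.swap)
  ultimately have "(\<Sum>i\<in>UNIV. \<Sum>j\<in>UNIV. S i j) = 0" by simp
  then show ?thesis using f g h by (simp add: PP S_def sum.distrib)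
qed

definition chart :: "complex ^ 'n::finite \<Rightarrow> 'n S2_prod_space" where
  "chart z = (\<chi> i. (z $ i / of_real (1 + (cmod (z $ i))\<^sup>2), 1 / (1 + (cmod (z $ i))\<^sup>2)))"

definition chart_inv :: "('n::finite) S2_prod_space \<Rightarrow> complex ^ 'n" where
  "chart_inv p = (\<chi> i. fst (p $ i) / of_real (snd (p $ i)))"

lemma chart_mem: "chart z \<in> S2_prod_pos"
proof -
  have p: "1 + (cmod (z $ i))\<^sup>2 > 0" for i by (smt (verit) zero_le_power2)
  have "(cmod (z $ i) / (1 + (cmod (z $ i))\<^sup>2))\<^sup>2 = 1 / (1 + (cmod (z $ i))\<^sup>2) * (1 - 1 / (1 + (cmod (z $ i))\<^sup>2))" for i
    using p[of i] by (simp add: field_simps power2_eq_square)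
  moreover have "cmod (1 + (complex_of_real (cmod (z $ i)))\<^sup>2) = 1 + (cmod (z $ i))\<^sup>2" for i
    using p[of i] by (metis abs_of_pos norm_of_real of_real_1 of_real_add of_real_power)
  ultimately show ?thesis
    using p by (auto simp: S2_prod_pos_def S2_prod_def S2_def chart_def norm_divide)
qed

lemma chart_inv_chart: "chart_inv (chart z) = z"
proof -
  have p: "1 + (cmod (z $ i))\<^sup>2 > 0" for i by (smt (verit) zero_le_power2)
  have "complex_of_real (1 + (cmod (z $ i))\<^sup>2) \<noteq> 0" for i using p[of i] by (simp only: of_real_eq_0_iff) 
  then show ?thesis by (simp add: chart_def chart_inv_def vec_eq_iff)
qed

lemma chart_chart_inv:
  assumes "p \<in> S2_prod_pos" shows "chart (chart_inv p) = p"
proof -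
  have *: "snd (p $ i) > 0" "(cmod (fst (p $ i)))\<^sup>2 = snd (p $ i) * (1 - snd (p $ i))" for i
    using assms by (auto simp: S2_prod_pos_def S2_prod_def S2_def split: prod.splits)
  have "1 + (cmod (chart_inv p $ i))\<^sup>2 = 1 / snd (p $ i)" for i
    using *[of i] by (simp add: chart_inv_def norm_divide power_divide) (simp add: field_simps power2_eq_square)
  then show ?thesis using *(1)
    by (simp add: chart_def vec_eq_iff prod_eq_iff del: of_real_add) (simp add: chart_inv_def less_imp_neq[symmetric])
qed


definition std_bracket :: "(('n::finite) S2_prod_space \<Rightarrow> complex) \<Rightarrow> ('n S2_prod_space \<Rightarrow> complex) \<Rightarrow>
    'n S2_prod_space \<Rightarrow> complex" where
  "std_bracket f g p = chart_bracket (f \<circ> chart) (g \<circ> chart) (chart_inv p)"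

lemma chart_bracket_antisym: "chart_bracket f g z = - chart_bracket g f z"
  by (simp add: chart_bracket_def sum_negf[symmetric] algebra_simps)

lemma chart_bracket_add:
  "f \<in> chart_funs \<Longrightarrow> g \<in> chart_funs \<Longrightarrow>
    chart_bracket (\<lambda>z. f z + g z) h z = chart_bracket f h z + chart_bracket g h z"
  by (simp add: chart_bracket_def sum.distrib[symmetric] wir_add algebra_simps)

lemma chart_bracket_mult:
  "f \<in> chart_funs \<Longrightarrow> g \<in> chart_funs \<Longrightarrow>
    chart_bracket (\<lambda>z. f z * g z) h z = f z * chart_bracket g h z + chart_bracket f h z * g z"
  by (simp add: chart_bracket_def sum.distrib[symmetric] sum_distrib_left sum_distrib_right wir_mult algebra_simps)

lemma chart_bracket_const: "chart_bracket (\<lambda>_. c) g z = 0"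
  by (simp add: chart_bracket_def wir_const)

lemma chart_bracket_cnj:
  "f \<in> chart_funs \<Longrightarrow> g \<in> chart_funs \<Longrightarrow>
    chart_bracket (cnj \<circ> f) (cnj \<circ> g) z = - cnj (chart_bracket f g z)"
  by (simp add: chart_bracket_def sum_negf[symmetric] wir_cnj algebra_simps)

lemma chart_bracket_delta:
  assumes "\<And>b k. k \<noteq> i \<Longrightarrow> wir b k f z = 0" "\<And>b k. k \<noteq> j \<Longrightarrow> wir b k g z = 0"
  shows "chart_bracket f g z = (if i = j then 2 * (1 + z $ i * cnj (z $ i)) *
     (wir False i f z * wir True i g z - wir True i f z * wir False i g z) else 0)"
proof -
  have "chart_bracket f g z = (\<Sum>k\<in>UNIV. if k = i then (if i = j then 2 * (1 + z $ i * cnj (z $ i)) *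
     (wir False i f z * wir True i g z - wir True i f z * wir False i g z) else 0) else 0)"
    unfolding chart_bracket_def using assms by (intro sum.cong) (auto simp: chart_z_def)
  then show ?thesis by simp
qed

definition chart_a :: "'n::finite \<Rightarrow> complex ^ 'n \<Rightarrow> complex" where
  "chart_a i z = chart_z i z * chart_r i z ^ 2"

lemma chart_a_mem: "chart_a i \<in> chart_funs"
  unfolding chart_a_def[abs_def] by (intro chart_funs_intros chart_funs_gen)

lemma wir_a: "wir b k (chart_a i) z =
    (if k = i then (if b then - (z $ i ^ 2) else 1) * chart_r i z ^ 4 else 0)"
proof -
  have "wir b k (chart_a i) z = chart_z i z * (2 * chart_r i z * wir b k (chart_r i) z)
      + wir b k (chart_z i) z * chart_r i z ^ 2"
    unfolding chart_a_def[abs_def]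
    by (subst wir_mult[OF chart_funs_gen(1) chart_funs_intros(5)[OF chart_funs_gen(2)]],
        subst wir_power[OF chart_funs_gen(2)]) simp
  moreover have "r ^ 2 - x * y * r ^ 4 = r ^ 4" if "r * r * (1 + x * y) = 1" for r x y :: complex
    using that by algebra
  note this[OF chart_r_sq[of i z]]
  ultimately show ?thesis
    by (auto simp: wir_z wir_r chart_z_def power2_eq_square power3_eq_cube power4_eq_xxxx algebra_simps)
qed

lemma bracket_a_a: "chart_bracket (chart_a i) (chart_a j) z = 0"
  by (subst chart_bracket_delta[of i _ _ j]) (auto simp: wir_a)

lemma bracket_r_r: "chart_bracket (chart_r i) (chart_r j) z = 0"
  by (subst chart_bracket_delta[of i _ _ j]) (auto simp: wir_r)

lemma bracket_a_r:
  "chart_bracket (chart_a i) (chart_r j) z = (if i = j then - chart_a i z * chart_r i z else 0)"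
proof -
  have *: "2 * (1 + x * y) * (r ^ 4 * (- (1 / 2) * x * r ^ 3) - (- (x ^ 2)) * r ^ 4 * (- (1 / 2) * y * r ^ 3))
      = - (x * r ^ 2) * r" if "r * r * (1 + x * y) = 1" for r x y :: complex
  proof -
    have "2 * (1 + x * y) * (r ^ 4 * (- (1 / 2) * x * r ^ 3) - (- (x ^ 2)) * r ^ 4 * (- (1 / 2) * y * r ^ 3))
      = - x * r ^ 3 * (r * r * (1 + x * y)) * (r * r * (1 + x * y))" by algebra
    then show ?thesis using that by (simp add: power3_eq_cube power2_eq_square)
  qed
  show ?thesis
    by (subst chart_bracket_delta[of i _ _ j])
       (use *[OF chart_r_sq[of i z]] in \<open>auto simp: wir_a wir_r chart_z_def chart_a_def\<close>)
qed

lemma bracket_a_cnj_a: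
  "chart_bracket (chart_a i) (cnj \<circ> chart_a j) z =
    (if i = j then 2 * (chart_r i z ^ 4 - chart_a i z * cnj (chart_a i z)) else 0)"
proof -
  have *: "2 * (1 + x * y) * (r ^ 4 * r ^ 4 - x ^ 2 * r ^ 4 * (y ^ 2 * r ^ 4))
      = 2 * (r ^ 4 - x * r ^ 2 * (y * r ^ 2))" if "r * r * (1 + x * y) = 1" for r x y :: complex
  proof -
    have "2 * (1 + x * y) * (r ^ 4 * r ^ 4 - x ^ 2 * r ^ 4 * (y ^ 2 * r ^ 4))
      = 2 * r ^ 4 * (1 - x * y) * (r * r * (1 + x * y)) * (r * r * (1 + x * y))" by algebra
    also have "\<dots> = 2 * (r ^ 4 - x * r ^ 2 * (y * r ^ 2))" unfolding that by algebra
    finally show ?thesis .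
  qed
  have r: "cnj (chart_r k z) = chart_r k z" for k by (simp add: chart_r_def)
  show ?thesis
    by (subst chart_bracket_delta[of i _ _ j])
       (use *[OF chart_r_sq[of i z]] in
         \<open>auto simp: wir_a wir_cnj[OF chart_a_mem] chart_z_def chart_a_def r simp del: o_apply\<close>)
qed

lemma sqrt_tau_chart: "sqrt_tau i \<circ> chart = chart_r i"
  by (auto simp: sqrt_tau_def chart_def chart_r_def cmod_power2 real_sqrt_inverse inverse_eq_divide real_sqrt_divide add.assoc)

lemma tau_chart: "tau i \<circ> chart = (\<lambda>z. chart_r i z * chart_r i z)"
proof
  fix z :: "complex ^ 'a"
  have "snd (chart z $ i) > 0" using chart_mem[of z] by (auto simp: S2_prod_pos_def)
  then have "tau i (chart z) = sqrt_tau i (chart z) * sqrt_tau i (chart z)"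
    by (simp add: tau_def sqrt_tau_def flip: of_real_mult)
  then show "(tau i \<circ> chart) z = chart_r i z * chart_r i z"
    using sqrt_tau_chart[of i] by (auto simp: fun_eq_iff)
qed

lemma alpha_chart: "alpha i \<circ> chart = chart_a i"
proof
  fix z :: "complex ^ 'a"
  have "alpha i (chart z) = z $ i * tau i (chart z)" by (simp add: alpha_def tau_def chart_def)
  then show "(alpha i \<circ> chart) z = chart_a i z"
    using tau_chart[of i] by (auto simp: fun_eq_iff chart_a_def chart_z_def power2_eq_square)
qed

lemma half_poly_alt:
  "(half_poly_S2_prod :: (('n::finite) S2_prod_space \<Rightarrow> complex) set) =
    poly_funs S2_prod_pos (range alpha \<union> range sqrt_tau)"
proof
  show "poly_funs S2_prod_pos (range alpha \<union> range sqrt_tau) \<subseteq> (half_poly_S2_prod :: ('n S2_prod_space \<Rightarrow> complex) set)"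
  proof
    fix f :: "'n S2_prod_space \<Rightarrow> complex"
    assume "f \<in> poly_funs S2_prod_pos (range alpha \<union> range sqrt_tau)"
    then show "f \<in> half_poly_S2_prod"
      unfolding half_poly_S2_prod_def
      by induction (blast intro: poly_funs.intros)+
  qed
  show "(half_poly_S2_prod :: ('n S2_prod_space \<Rightarrow> complex) set) \<subseteq> poly_funs S2_prod_pos (range alpha \<union> range sqrt_tau)"
  proof
    have sq: "tau i p = sqrt_tau i p * sqrt_tau i p" if "p \<in> S2_prod_pos" for i and p :: "'n S2_prod_space"
      using that by (auto simp: S2_prod_pos_def tau_def sqrt_tau_def less_imp_le simp flip: of_real_mult)
    have m: "(\<lambda>p :: 'n S2_prod_space. sqrt_tau i p * sqrt_tau i p) \<in> poly_funs S2_prod_pos (range alpha \<union> range sqrt_tau)" for i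
      by (intro poly_funs.mult poly_funs.gen) auto
    have t: "tau i \<in> poly_funs S2_prod_pos (range alpha \<union> range sqrt_tau)" for i :: 'n
      by (rule poly_funs.cong[OF m sq])
    fix f :: "'n S2_prod_space \<Rightarrow> complex"
    assume "f \<in> half_poly_S2_prod"
    then show "f \<in> poly_funs S2_prod_pos (range alpha \<union> range sqrt_tau)"
      unfolding half_poly_S2_prod_def
    proof induction
      case (gen f) then show ?case using t by (auto intro: poly_funs.gen)
    next
      case (gen_cnj f) then show ?case using poly_funs_cnj[OF t] by (blast intro: poly_funs.gen_cnj)
    qed (blast intro: poly_funs.intros)+
  qed
qed

lemma half_poly_chart: "f \<in> half_poly_S2_prod \<Longrightarrow> f \<circ> chart \<in> chart_funs"
  unfolding half_poly_alt
proof (induction rule: poly_funs.induct)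
  case (gen f)
  then show ?case using chart_a_mem by (auto simp: alpha_chart sqrt_tau_chart simp del: o_apply)
next
  case (gen_cnj f)
  then have "f \<circ> chart \<in> chart_funs" using chart_a_mem by (auto simp: alpha_chart sqrt_tau_chart simp del: o_apply)
  then show ?case unfolding comp_assoc by (rule chart_funs_intros)
next
  case (const c) then show ?case by (simp add: o_def)
next
  case (add f g) then show ?case by (simp add: o_def chart_funs_intros)
next
  case (mult f g) then show ?case by (simp add: o_def chart_funs_intros)
next
  case (cong f g)
  then have "g \<circ> chart = f \<circ> chart" by (intro ext) (simp add: chart_mem)
  with cong show ?case by simp
qed

lemma std_bracket_chart: "std_bracket f g \<circ> chart = chart_bracket (f \<circ> chart) (g \<circ> chart)"
  by (auto simp: std_bracket_def chart_inv_chart)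

lemma comp_ops:
  "(\<lambda>p. f p + g p) \<circ> h = (\<lambda>z. (f \<circ> h) z + (g \<circ> h) z)"
  "(\<lambda>p. f p * g p) \<circ> h = (\<lambda>z. (f \<circ> h) z * (g \<circ> h) z)"
  "(\<lambda>p. c) \<circ> h = (\<lambda>z. c)"
  by auto

lemma std_bracket_antisym: "std_bracket f g p = - std_bracket g f p"
  unfolding std_bracket_def by (rule chart_bracket_antisym)

lemma std_bracket_respects:
  "(\<And>p. p \<in> S2_prod_pos \<Longrightarrow> f p = f' p) \<Longrightarrow> std_bracket f g = std_bracket f' g"
proof -
  assume "\<And>p. p \<in> S2_prod_pos \<Longrightarrow> f p = f' p"
  then have "f \<circ> chart = f' \<circ> chart" by (intro ext) (simp add: chart_mem)
  then show ?thesis by (intro ext) (simp only: std_bracket_def)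
qed

lemma std_bracket_add:
  "f \<in> half_poly_S2_prod \<Longrightarrow> g \<in> half_poly_S2_prod \<Longrightarrow>
    std_bracket (\<lambda>p. f p + g p) h p = std_bracket f h p + std_bracket g h p"
  unfolding std_bracket_def comp_ops by (intro chart_bracket_add half_poly_chart)

lemma std_bracket_mult:
  assumes "f \<in> half_poly_S2_prod" "g \<in> half_poly_S2_prod" "p \<in> S2_prod_pos"
  shows "std_bracket (\<lambda>p. f p * g p) h p = f p * std_bracket g h p + std_bracket f h p * g p"
  unfolding std_bracket_def comp_ops using assms
  by (subst chart_bracket_mult) (simp_all add: half_poly_chart chart_chart_inv)

lemma std_bracket_closed_left:
  assumes f: "f \<in> half_poly_S2_prod"
    and gen: "\<And>f. f \<in> range alpha \<union> range sqrt_tau \<Longrightarrow> std_bracket f g \<in> half_poly_S2_prod"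
      "\<And>f. f \<in> range alpha \<union> range sqrt_tau \<Longrightarrow> std_bracket (cnj \<circ> f) g \<in> half_poly_S2_prod"
  shows "std_bracket f g \<in> half_poly_S2_prod"
  using f unfolding half_poly_alt
proof (induction rule: poly_funs.induct)
  case (gen f) then show ?case using assms(2) unfolding half_poly_alt by blast
next
  case (gen_cnj f) then show ?case using assms(3) unfolding half_poly_alt by blast
next
  case (const c)
  have "std_bracket (\<lambda>_. c) g = (\<lambda>_. 0)" by (rule ext) (simp add: std_bracket_def comp_ops chart_bracket_const)
  then show ?case by (simp add: poly_funs.const)
next
  case (add f f')
  then have "std_bracket (\<lambda>p. f p + f' p) g = (\<lambda>p. std_bracket f g p + std_bracket f' g p)"
    by (intro ext std_bracket_add) (simp_all add: half_poly_alt)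
  with add show ?case by (simp add: poly_funs.add)
next
  case (mult f f')
  show ?case
    by (rule poly_funs.cong[OF poly_funs.add[OF poly_funs.mult[OF mult(1) mult(4)] poly_funs.mult[OF mult(3) mult(2)]]])
       (use mult in \<open>auto intro!: std_bracket_mult simp: half_poly_alt\<close>)
next
  case (cong f f')
  then show ?case using std_bracket_respects[of f' f g] by simp
qed

lemma std_bracket_gens:
  assumes "p \<in> S2_prod_pos"
  shows "std_bracket (alpha i) (alpha j) p = 0"
    and "std_bracket (sqrt_tau i) (sqrt_tau j) p = 0"
    and "std_bracket (alpha i) (sqrt_tau j) p = (if i = j then - alpha i p * sqrt_tau i p else 0)"
    and "std_bracket (alpha i) (cnj \<circ> alpha j) p =
        (if i = j then 2 * ((tau i p)\<^sup>2 - alpha i p * cnj (alpha i p)) else 0)"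
proof -
  obtain z where p: "p = chart z" using chart_chart_inv[OF assms] by metis
  have e: "alpha i p = chart_a i z" "sqrt_tau i p = chart_r i z" "tau i p = chart_r i z * chart_r i z" for i
    using alpha_chart[of i] sqrt_tau_chart[of i] tau_chart[of i] by (auto simp: p fun_eq_iff)
  have c: "(cnj \<circ> alpha j) \<circ> chart = cnj \<circ> chart_a j"
    by (simp add: comp_assoc alpha_chart)
  show "std_bracket (alpha i) (alpha j) p = 0"
    "std_bracket (sqrt_tau i) (sqrt_tau j) p = 0"
    "std_bracket (alpha i) (sqrt_tau j) p = (if i = j then - alpha i p * sqrt_tau i p else 0)"
    "std_bracket (alpha i) (cnj \<circ> alpha j) p =
        (if i = j then 2 * ((tau i p)\<^sup>2 - alpha i p * cnj (alpha i p)) else 0)"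
    unfolding std_bracket_def c alpha_chart sqrt_tau_chart e
    by (simp_all add: p chart_inv_chart bracket_a_a bracket_r_r bracket_a_r bracket_a_cnj_a
        power2_eq_square power4_eq_xxxx mult.assoc)
qed

lemma std_bracket_cnj:
  "f \<in> half_poly_S2_prod \<Longrightarrow> g \<in> half_poly_S2_prod \<Longrightarrow>
    std_bracket (cnj \<circ> f) (cnj \<circ> g) p = - cnj (std_bracket f g p)"
  unfolding std_bracket_def comp_assoc by (intro chart_bracket_cnj half_poly_chart)

lemma half_poly_gens [simp]:
  "alpha i \<in> half_poly_S2_prod" "tau i \<in> half_poly_S2_prod" "sqrt_tau i \<in> half_poly_S2_prod"
  by (auto simp: half_poly_S2_prod_def intro: poly_funs.gen)

lemma std_bracket_gens_closed:
  assumes "f \<in> range alpha \<union> range sqrt_tau" "g \<in> range alpha \<union> range sqrt_tau"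
  shows "std_bracket f g \<in> half_poly_S2_prod"
    and "std_bracket f (cnj \<circ> g) \<in> half_poly_S2_prod"
proof -
  have cr: "cnj \<circ> sqrt_tau i = sqrt_tau i" for i :: 'a by (auto simp: sqrt_tau_def)
  note H = half_poly_S2_prod_def
  have if0: "(\<lambda>p. if P then f p else 0) \<in> half_poly_S2_prod" if "f \<in> half_poly_S2_prod"
    for P and f :: "'a S2_prod_space \<Rightarrow> complex"
    using that poly_funs.const[of 0] unfolding H by (cases P) simp_all
  have ca: "cnj \<circ> alpha i \<in> half_poly_S2_prod" for i :: 'a
    using poly_funs_cnj half_poly_gens(1) unfolding H by blast
  have mem1: "(\<lambda>p. 0) \<in> (half_poly_S2_prod :: ('a S2_prod_space \<Rightarrow> complex) set)"
    unfolding H by (rule poly_funs.const)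
  have mem2: "(\<lambda>p. if i = j then - (alpha i p * sqrt_tau i p) else 0) \<in> half_poly_S2_prod" for i j :: 'a
    by (rule if0, unfold H, intro poly_funs_minus poly_funs.mult) (simp_all add: half_poly_gens[unfolded H])
  have mem3: "(\<lambda>p. if i = j then 2 * ((tau i p)\<^sup>2 - alpha i p * (cnj \<circ> alpha i) p) else 0) \<in> half_poly_S2_prod" for i j :: 'a
    by (rule if0, unfold H, intro poly_funs.const poly_funs.mult poly_funs_diff poly_funs_power)
       (simp_all only: half_poly_gens[unfolded H] ca[unfolded H])
  have neg: "std_bracket g f \<in> half_poly_S2_prod" if "std_bracket f g \<in> half_poly_S2_prod" for f g :: "'a S2_prod_space \<Rightarrow> complex"
  proof -
    have "std_bracket g f = (\<lambda>p. - std_bracket f g p)" by (rule ext) (rule std_bracket_antisym)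
    then show ?thesis using that poly_funs_minus unfolding H by metis
  qed
  have aa: "std_bracket (alpha i) (alpha j) \<in> half_poly_S2_prod" for i j :: 'a
    unfolding H by (rule poly_funs.cong[OF mem1[unfolded H]]) (simp add: std_bracket_gens)
  have rr: "std_bracket (sqrt_tau i) (sqrt_tau j) \<in> half_poly_S2_prod" for i j :: 'a
    unfolding H by (rule poly_funs.cong[OF mem1[unfolded H]]) (simp add: std_bracket_gens)
  have ar: "std_bracket (alpha i) (sqrt_tau j) \<in> half_poly_S2_prod" for i j :: 'a
    unfolding H by (rule poly_funs.cong[OF mem2[of i j, unfolded H]]) (simp add: std_bracket_gens)
  have ac: "std_bracket (alpha i) (cnj \<circ> alpha j) \<in> half_poly_S2_prod" for i j :: 'a
    unfolding H by (rule poly_funs.cong[OF mem3[of i j, unfolded H]]) (simp add: std_bracket_gens)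
  note 1 = aa rr ar ac
  have 2: "std_bracket (sqrt_tau i) (cnj \<circ> alpha j) \<in> half_poly_S2_prod" for i j :: 'a
  proof -
    have "std_bracket (sqrt_tau i) (cnj \<circ> alpha j) = (\<lambda>p. - (cnj \<circ> std_bracket (sqrt_tau i) (alpha j)) p)"
      using std_bracket_cnj[of "sqrt_tau i" "alpha j"] by (simp add: cr fun_eq_iff)
    then show ?thesis
      using poly_funs_minus[OF poly_funs_cnj[OF neg[OF ar, unfolded H]]] unfolding H by simp
  qed
  show "std_bracket f g \<in> half_poly_S2_prod" using assms 1 neg by auto
  show "std_bracket f (cnj \<circ> g) \<in> half_poly_S2_prod" using assms 1 2 cr by auto
qed

lemma std_bracket_closed:
  assumes "f \<in> half_poly_S2_prod" "g \<in> half_poly_S2_prod"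
  shows "std_bracket f g \<in> half_poly_S2_prod"
proof -
  note H = half_poly_S2_prod_def
  have neg: "std_bracket g f \<in> half_poly_S2_prod" if "std_bracket f g \<in> half_poly_S2_prod" for f g :: "'a S2_prod_space \<Rightarrow> complex"
  proof -
    have "std_bracket g f = (\<lambda>p. - std_bracket f g p)" by (rule ext) (rule std_bracket_antisym)
    then show ?thesis using that poly_funs_minus unfolding H by metis
  qed
  have cc: "std_bracket (cnj \<circ> f) (cnj \<circ> g) \<in> half_poly_S2_prod"
    if fg: "f \<in> range alpha \<union> range sqrt_tau" "g \<in> range alpha \<union> range sqrt_tau" for f g :: "'a S2_prod_space \<Rightarrow> complex"
  proof -
    have "f \<in> half_poly_S2_prod" "g \<in> half_poly_S2_prod" using fg by auto
    then have "std_bracket (cnj \<circ> f) (cnj \<circ> g) = (\<lambda>p. - (cnj \<circ> std_bracket f g) p)"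
      by (simp add: std_bracket_cnj fun_eq_iff)
    then show ?thesis
      using poly_funs_minus[OF poly_funs_cnj[OF std_bracket_gens_closed(1)[OF fg, unfolded H]]] unfolding H by simp
  qed
  have g1: "std_bracket g h \<in> half_poly_S2_prod"
    if g: "g \<in> half_poly_S2_prod" and h: "h \<in> range alpha \<union> range sqrt_tau"
    for g h :: "'a S2_prod_space \<Rightarrow> complex"
    using g std_bracket_gens_closed(1)[OF _ h] neg[OF std_bracket_gens_closed(2)[OF h]]
    by (rule std_bracket_closed_left)
  have g2: "std_bracket g (cnj \<circ> h) \<in> half_poly_S2_prod"
    if g: "g \<in> half_poly_S2_prod" and h: "h \<in> range alpha \<union> range sqrt_tau"
    for g h :: "'a S2_prod_space \<Rightarrow> complex"
    using g std_bracket_gens_closed(2)[OF _ h] cc[OF _ h] by (rule std_bracket_closed_left)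
  show ?thesis
    using assms(1) neg[OF g1[OF assms(2)]] neg[OF g2[OF assms(2)]] by (rule std_bracket_closed_left)
qed

lemma standard_product_bracket_std_bracket: "standard_product_bracket std_bracket"
proof (rule standard_product_bracket.intro)
  show "poisson_bracket S2_prod_pos half_poly_S2_prod std_bracket"
  proof (rule poisson_bracket.intro, goal_cases)
    case (1 f g) then show ?case by (rule std_bracket_closed)
  next
    case (2 f f' g) then show ?case using std_bracket_respects by metis
  next
    case 3 show ?case by (rule std_bracket_antisym)
  next
    case (4 f g h x) then show ?case by (intro std_bracket_add)
  next
    case (5 f g x c)
    then show ?case
      unfolding std_bracket_def comp_ops
      by (subst chart_bracket_mult) (simp_all add: half_poly_chart chart_bracket_const)
  next
    case (6 f g h x) then show ?case by (intro std_bracket_mult)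
  next
    case (7 f g h x)
    then show ?case
      unfolding std_bracket_def[of _ "std_bracket _ _"] std_bracket_chart
      by (intro chart_bracket_jacobi half_poly_chart)
  next
    case (8 f g x) then show ?case by (intro std_bracket_cnj)
  qed
  have sq: "tau i p = sqrt_tau i p * sqrt_tau i p" if "p \<in> S2_prod_pos" for i and p :: "'a S2_prod_space"
    using that by (auto simp: S2_prod_pos_def tau_def sqrt_tau_def less_imp_le simp flip: of_real_mult)
  have t: "std_bracket (tau i) f p = 2 * sqrt_tau i p * std_bracket (sqrt_tau i) f p"
    if p: "p \<in> S2_prod_pos" for i f and p :: "'a S2_prod_space"
  proof -
    have "std_bracket (tau i) f p = std_bracket (\<lambda>p. sqrt_tau i p * sqrt_tau i p) f p"
      by (subst std_bracket_respects[OF sq]) simp_all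
    then show ?thesis using std_bracket_mult[of "sqrt_tau i" "sqrt_tau i" p f] p by simp
  qed
  show "standard_product_bracket_axioms (std_bracket :: ('a S2_prod_space \<Rightarrow> complex) \<Rightarrow> _)"
  proof (rule standard_product_bracket_axioms.intro, goal_cases)
    case (1 p i j)
    have "std_bracket (alpha i) (tau j) p = - std_bracket (tau j) (alpha i) p"
      by (rule std_bracket_antisym)
    also have "\<dots> = 2 * sqrt_tau j p * std_bracket (alpha i) (sqrt_tau j) p"
      using t[OF 1, of j "alpha i"] std_bracket_antisym[of "sqrt_tau j" "alpha i" p] by simp
    finally show ?case using 1 by (simp add: std_bracket_gens sq)
  next
    case (2 p i j) then show ?case by (rule std_bracket_gens(4))
  next
    case (3 p i j) then show ?case by (simp add: std_bracket_gens)
  next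
    case (4 p i j)
    have "std_bracket (sqrt_tau i) (tau j) p = - std_bracket (tau j) (sqrt_tau i) p"
      by (rule std_bracket_antisym)
    then show ?case using 4 by (simp add: t std_bracket_gens)
  qed
qed

end

theory Submission
  imports Defs
begin

text \<open>
  Where all \<open>\<tau>\<^sub>i\<close> are positive, the functions \<open>\<alpha>\<^sub>i\<close>, \<open>\<alpha>\<^sub>i\<^sup>*\<close> and \<open>\<tau>\<^sub>i\<^sup>1\<^sup>/\<^sup>2\<close> are log-canonical up to one
  exception: the bracket of two of them is a constant times their product, except for
  \<open>{\<alpha>\<^sub>i, \<alpha>\<^sub>i\<^sup>*}\<close>.  By the Leibniz rule such constants add up under products.  Since \<open>\<Phi>\<close> pulls the
  coordinates \<open>a\<^sub>i\<close> and \<open>t\<close> back to monomials, most of the claimed brackets amount to arithmetic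
  with the exponents: \<open>2 (M\<^sub>k\<^sub>l - M\<^sub>l\<^sub>k) = 1\<close> for \<open>{a\<^sub>k, a\<^sub>l}\<close> with \<open>k < l\<close>,
  \<open>- 2 (M\<^sub>k\<^sub>l + M\<^sub>l\<^sub>k) = - 3\<close> for \<open>{a\<^sub>k, a\<^sub>l\<^sup>*}\<close>, and \<open>- 2\<close> for \<open>{a\<^sub>i, t}\<close>
  (\<open>alpha_monomials\<close>, \<open>alpha_monomial_cnj\<close>, \<open>alpha_monomial_sqrt_tau_monomial\<close>).

  The remaining bracket is \<open>{a\<^sub>k, a\<^sub>k\<^sup>*} = 2 (\<tau>\<^sub>k\<^sup>2 - |\<alpha>\<^sub>k|\<^sup>2) \<Prod>\<^sub>j \<tau>\<^sub>j\<^bsup>2 M\<^sub>k\<^sub>j\<^esup>\<close>.  For a set \<open>S\<close> of indices let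
  \<open>W(S)\<close> be the product of \<open>\<tau>\<^sub>j\<close> over \<open>j \<in> S\<close> and of \<open>\<tau>\<^sub>j\<^sup>2\<close> over \<open>j \<notin> S\<close>.  The choice of \<open>M\<close> gives
  \<open>|a\<^sub>l|\<^sup>2 = W({..l}) - W({..<l})\<close>, so sums of \<open>|a\<^sub>l|\<^sup>2\<close> along the linear order telescope, starting
  from \<open>W({}) = t\<^sup>2\<close>.  Summing over all \<open>l\<close> yields \<open>W(UNIV) - t\<^sup>2 = t - t\<^sup>2\<close>, that is, \<open>\<Phi>\<close> maps
  into the sphere; summing over \<open>l < k\<close> turns \<open>\<tau>\<^sub>k\<^sup>2 \<Prod>\<^sub>j \<tau>\<^sub>j\<^bsup>2 M\<^sub>k\<^sub>j\<^esup> = W({..<k})\<close> into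
  \<open>t\<^sup>2 + \<Sum>\<^sub>l\<^sub><\<^sub>k |a\<^sub>l|\<^sup>2\<close>, which is the claim.  The same telescoping, read as
  \<open>\<tau>\<^sub>k = W({..<k}) / W({..k})\<close>, inverts \<open>\<Phi>\<close> on the part \<open>t > 0\<close> of the sphere (\<open>Phi_surj\<close>).

  The sphere has just one further point, the origin.  Polynomial functions are continuous, so they
  are determined by their values at \<open>t > 0\<close>, hence by their pullbacks along \<open>\<Phi>\<close>.  Therefore
  \<open>{f, g}\<close> may be defined as the unique polynomial function with pullback \<open>{f \<circ> \<Phi>, g \<circ> \<Phi>}\<close>.  It
  exists for all \<open>f\<close> and \<open>g\<close> because it does for the coordinates, and every law of a Poisson bracket
  is inherited from the product of the spheres (\<open>coinduced_exists\<close>).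
\<close>

section \<open>Brackets coinduced by a map\<close>

context poisson_bracket
begin

lemma respects_right:
  "f \<in> A \<Longrightarrow> g \<in> A \<Longrightarrow> g' \<in> A \<Longrightarrow> (\<And>y. y \<in> X \<Longrightarrow> g y = g' y) \<Longrightarrow> x \<in> X \<Longrightarrow> B f g x = B f g' x"
  using respects[of g g' f x] antisym[of f g x] antisym[of f g' x] by simp

lemma respects_both:
  assumes "f \<in> A" "f' \<in> A" "g \<in> A" "g' \<in> A" "x \<in> X"
    and "\<And>y. y \<in> X \<Longrightarrow> f y = f' y" "\<And>y. y \<in> X \<Longrightarrow> g y = g' y"
  shows "B f g x = B f' g' x"
proof -
  have "B f g x = B f' g x" using assms by (intro respects)
  also have "\<dots> = B f' g' x" using assms by (intro respects_right)
  finally show ?thesis .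
qed

lemma self_zero: "f \<in> A \<Longrightarrow> x \<in> X \<Longrightarrow> B f f x = 0"
  using antisym[of f f x] by simp

lemma const_zero:
  assumes "(\<lambda>_. 1) \<in> A" "g \<in> A" "x \<in> X"
  shows "B (\<lambda>_. c) g x = 0"
proof -
  have "B (\<lambda>_. 1) g x = 0" using leibniz[of "\<lambda>_. 1" "\<lambda>_. 1" g x] assms by simp
  then show ?thesis using scale[of "\<lambda>_. 1" g x c] assms by simp
qed

text \<open>
  The image of \<open>F\<close> need not be all of \<open>Y\<close>; it is enough that it separates polynomial functions.
  Each Poisson law on \<open>Y\<close> is an identity between polynomial functions, so it holds because its
  pullback does.  Only brackets of generators have to be seen to be pullbacks: pullbacks are
  closed under sums and products, and antisymmetry and reality supply the other combinations of
  generators with their conjugates.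
\<close>

lemma coinduced_exists:
  fixes Y :: "'q set" and G :: "('q \<Rightarrow> complex) set" and F :: "'p \<Rightarrow> 'q"
  assumes into: "F ` X \<subseteq> Y"
    and pull: "\<And>f. f \<in> poly_funs Y G \<Longrightarrow> f \<circ> F \<in> A"
    and determined: "\<And>f g y. f \<in> poly_funs Y G \<Longrightarrow> g \<in> poly_funs Y G \<Longrightarrow>
      (\<And>x. x \<in> X \<Longrightarrow> f (F x) = g (F x)) \<Longrightarrow> y \<in> Y \<Longrightarrow> f y = g y"
    and gens: "\<And>f g. f \<in> G \<Longrightarrow> g \<in> G \<Longrightarrow>
      \<exists>h\<in>poly_funs Y G. \<forall>x\<in>X. B (f \<circ> F) (g \<circ> F) x = h (F x)"
    and gens_cnj: "\<And>f g. f \<in> G \<Longrightarrow> g \<in> G \<Longrightarrow>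
      \<exists>h\<in>poly_funs Y G. \<forall>x\<in>X. B (f \<circ> F) ((cnj \<circ> g) \<circ> F) x = h (F x)"
  shows "\<exists>C. poisson_bracket Y (poly_funs Y G) C \<and>
    (\<forall>f\<in>poly_funs Y G. \<forall>g\<in>poly_funs Y G. \<forall>x\<in>X. B (f \<circ> F) (g \<circ> F) x = C f g (F x))"
proof -
  define P where "P = poly_funs Y G"
  define descends where
    "descends f g \<longleftrightarrow> (\<exists>h\<in>P. \<forall>x\<in>X. B (f \<circ> F) (g \<circ> F) x = h (F x))" for f g
  note P_intros =
    poly_funs.add[where X = Y and G = G, folded P_def]
    poly_funs.mult[where X = Y and G = G, folded P_def]
    poly_funs.const[where X = Y and G = G, folded P_def]
    poly_funs_minus[where X = Y and G = G, folded P_def]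
    poly_funs_cnj[where X = Y and G = G, folded P_def]
  have pull: "f \<circ> F \<in> A" if "f \<in> P" for f using pull that by (simp add: P_def)
  have one: "(\<lambda>_. 1) \<in> A" using pull[OF P_intros(3)[of 1]] by (simp add: o_def)
  have GP: "f \<in> P" "cnj \<circ> f \<in> P" if "f \<in> G" for f
    using that by (auto simp: P_def intro: poly_funs.gen poly_funs.gen_cnj)
  have descends_swap: "descends g f" if fg: "f \<in> P" "g \<in> P" and "descends f g" for f g
  proof -
    obtain h where "h \<in> P" "\<forall>x\<in>X. B (f \<circ> F) (g \<circ> F) x = h (F x)"
      using \<open>descends f g\<close> by (auto simp: descends_def)
    moreover have "B (g \<circ> F) (f \<circ> F) x = - B (f \<circ> F) (g \<circ> F) x" if "x \<in> X" for x
      by (intro antisym pull fg that)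
    ultimately show ?thesis unfolding descends_def
      by (intro bexI[of _ "\<lambda>y. - h y"]) (auto intro: P_intros)
  qed
  have descends_cnj: "descends (cnj \<circ> f) (cnj \<circ> g)" if fg: "f \<in> P" "g \<in> P" and "descends f g" for f g
  proof -
    obtain h where "h \<in> P" "\<forall>x\<in>X. B (f \<circ> F) (g \<circ> F) x = h (F x)"
      using \<open>descends f g\<close> by (auto simp: descends_def)
    moreover have "B ((cnj \<circ> f) \<circ> F) ((cnj \<circ> g) \<circ> F) x = - cnj (B (f \<circ> F) (g \<circ> F) x)" if "x \<in> X" for x
      unfolding comp_assoc by (intro reality pull fg that)
    ultimately show ?thesis unfolding descends_def
      by (intro bexI[of _ "\<lambda>y. - (cnj \<circ> h) y"] P_intros) simp_all
  qed
  have descends_left: "descends f g"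
    if f: "f \<in> P" and g: "g \<in> P"
      and G: "\<And>f. f \<in> G \<Longrightarrow> descends f g" "\<And>f. f \<in> G \<Longrightarrow> descends (cnj \<circ> f) g" for f g
    using f unfolding P_def
  proof (induction rule: poly_funs.induct)
    case (gen f) then show ?case by (rule G)
  next
    case (gen_cnj f) then show ?case by (rule G)
  next
    case (const c)
    have "B ((\<lambda>_. c) \<circ> F) (g \<circ> F) x = 0" if "x \<in> X" for x
      unfolding o_def[of "\<lambda>_. c"] by (intro const_zero one pull g that)
    then show ?case unfolding descends_def by (intro bexI[of _ "\<lambda>_. 0"]) (auto intro: P_intros)
  next
    case (add f f')
    then obtain h h' where h: "h \<in> P" "\<forall>x\<in>X. B (f \<circ> F) (g \<circ> F) x = h (F x)"
      "h' \<in> P" "\<forall>x\<in>X. B (f' \<circ> F) (g \<circ> F) x = h' (F x)"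
      by (auto simp: descends_def)
    have "f \<in> P" "f' \<in> P" using add by (simp_all add: P_def)
    then have "B ((\<lambda>y. f y + f' y) \<circ> F) (g \<circ> F) x = h (F x) + h' (F x)" if "x \<in> X" for x
      unfolding comp_ops using h that by (subst additive) (simp_all add: pull g)
    then show ?case unfolding descends_def
      by (intro bexI[of _ "\<lambda>y. h y + h' y"]) (auto intro: P_intros h)
  next
    case (mult f f')
    then obtain h h' where h: "h \<in> P" "\<forall>x\<in>X. B (f \<circ> F) (g \<circ> F) x = h (F x)"
      "h' \<in> P" "\<forall>x\<in>X. B (f' \<circ> F) (g \<circ> F) x = h' (F x)"
      by (auto simp: descends_def)
    have ff: "f \<in> P" "f' \<in> P" using mult by (simp_all add: P_def)
    then have "B ((\<lambda>y. f y * f' y) \<circ> F) (g \<circ> F) x = f (F x) * h' (F x) + h (F x) * f' (F x)"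
      if "x \<in> X" for x
      unfolding comp_ops using h that by (subst leibniz) (simp_all add: pull g)
    then show ?case unfolding descends_def
      by (intro bexI[of _ "\<lambda>y. f y * h' y + h y * f' y"] P_intros(1,2) h ff) simp
  next
    case (cong f f')
    have ff: "f \<in> P" "f' \<in> P"
      using cong(1) poly_funs.cong[OF cong(1), of f'] cong(2) by (simp_all add: P_def)
    have "B (f' \<circ> F) (g \<circ> F) x = B (f \<circ> F) (g \<circ> F) x" if "x \<in> X" for x
      using cong(2) into that by (intro respects pull ff g) auto
    then show ?case using cong(3) by (simp add: descends_def)
  qed
  have descends: "descends f g" if f: "f \<in> P" and g: "g \<in> P" for f g
  proof -
    have gg: "descends f g" "descends f (cnj \<circ> g)" "descends (cnj \<circ> f) g" "descends (cnj \<circ> f) (cnj \<circ> g)"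
      if fg: "f \<in> G" "g \<in> G" for f g
    proof -
      show 1: "descends f g" using gens[OF fg] by (simp add: descends_def P_def)
      show 2: "descends f (cnj \<circ> g)" using gens_cnj[OF fg] by (simp add: descends_def P_def)
      show "descends (cnj \<circ> f) (cnj \<circ> g)" by (intro descends_cnj GP fg 1)
      have "descends (cnj \<circ> f) (cnj \<circ> (cnj \<circ> g))" by (intro descends_cnj GP fg 2)
      moreover have "cnj \<circ> (cnj \<circ> g) = g" by auto
      ultimately show "descends (cnj \<circ> f) g" by simp
    qed
    have "descends f g'" "descends f (cnj \<circ> g')" if "g' \<in> G" for g'
      by (rule descends_left[OF f]; use that in \<open>blast intro: GP gg\<close>)+
    then have "descends g' f" "descends (cnj \<circ> g') f" if "g' \<in> G" for g'
      using that by (blast intro: descends_swap f GP)+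
    then have "descends g f" using g f by (blast intro: descends_left)
    then show ?thesis by (rule descends_swap[OF g f])
  qed
  define C where "C f g = (SOME h. h \<in> P \<and> (\<forall>x\<in>X. B (f \<circ> F) (g \<circ> F) x = h (F x)))" for f g
  have C: "C f g \<in> P" "\<And>x. x \<in> X \<Longrightarrow> B (f \<circ> F) (g \<circ> F) x = C f g (F x)"
    if "f \<in> P" "g \<in> P" for f g
  proof -
    have "\<exists>h. h \<in> P \<and> (\<forall>x\<in>X. B (f \<circ> F) (g \<circ> F) x = h (F x))"
      using descends[OF that] by (auto simp: descends_def)
    from someI_ex[OF this, folded C_def]
    show "C f g \<in> P" "\<And>x. x \<in> X \<Longrightarrow> B (f \<circ> F) (g \<circ> F) x = C f g (F x)"
      by blast+
  qed
  have det: "f y = g y" if "f \<in> P" "g \<in> P" "y \<in> Y" "\<And>x. x \<in> X \<Longrightarrow> f (F x) = g (F x)" for f g y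
    using determined[of f g y] that by (simp add: P_def)
  have "poisson_bracket Y P C"
  proof (rule poisson_bracket.intro, goal_cases)
    case (1 f g) then show ?case by (rule C)
  next
    case (2 f f' g y)
    have "B (f \<circ> F) (g \<circ> F) x = B (f' \<circ> F) (g \<circ> F) x" if "x \<in> X" for x
      using 2 into that by (intro respects pull) auto
    then have "C f g (F x) = C f' g (F x)" if "x \<in> X" for x
      using 2 that by (simp flip: C(2))
    from det[OF C(1)[OF 2(1,3)] C(1)[OF 2(2,3)] 2(5) this] show ?case .
  next
    case (3 f g y)
    show ?case
    proof (rule det[of _ "\<lambda>y. - C g f y"])
      show "C f g (F x) = - C g f (F x)" if "x \<in> X" for x
        using 3 that by (simp flip: C(2)) (intro antisym pull)
    qed (use 3 in \<open>simp_all add: C(1) P_intros\<close>)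
  next
    case (4 f g h y)
    show ?case
    proof (rule det[of _ "\<lambda>y. C f h y + C g h y"])
      show "C (\<lambda>y. f y + g y) h (F x) = C f h (F x) + C g h (F x)" if "x \<in> X" for x
        using 4 that by (simp add: P_intros comp_ops pull additive flip: C(2) del: o_apply)
    qed (use 4 in \<open>simp_all add: C(1) P_intros\<close>)
  next
    case (5 f g y c)
    show ?case
    proof (rule det[of _ "\<lambda>y. c * C f g y"])
      have "(\<lambda>y. c * f y) \<circ> F = (\<lambda>x. c * (f \<circ> F) x)" by auto
      then show "C (\<lambda>y. c * f y) g (F x) = c * C f g (F x)" if "x \<in> X" for x
        using 5 that by (simp add: P_intros pull scale flip: C(2) del: o_apply)
    qed (use 5 in \<open>simp_all add: C(1) P_intros\<close>)
  next
    case (6 f g h y)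
    show ?case
    proof (rule det[of _ "\<lambda>y. f y * C g h y + C f h y * g y"])
      show "C (\<lambda>y. f y * g y) h (F x) = f (F x) * C g h (F x) + C f h (F x) * g (F x)" if "x \<in> X" for x
        using 6 that by (simp add: P_intros comp_ops pull leibniz o_apply[of _ F x] flip: C(2) del: o_apply)
    qed (use 6 in \<open>simp_all add: C(1) P_intros\<close>)
  next
    case (7 f g h y)
    have nested: "C f (C g h) (F x) = B (f \<circ> F) (B (g \<circ> F) (h \<circ> F)) x"
      if "f \<in> P" "g \<in> P" "h \<in> P" "x \<in> X" for f g h x
    proof -
      have "C f (C g h) (F x) = B (f \<circ> F) (C g h \<circ> F) x" using that by (simp add: C)
      also have "\<dots> = B (f \<circ> F) (B (g \<circ> F) (h \<circ> F)) x"
        using that by (intro respects_right pull C closed) (simp_all add: C)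
      finally show ?thesis .
    qed
    show ?case
    proof (rule det[of "\<lambda>y. C f (C g h) y + C g (C h f) y + C h (C f g) y" "\<lambda>_. 0"])
      show "C f (C g h) (F x) + C g (C h f) (F x) + C h (C f g) (F x) = 0" if "x \<in> X" for x
        using 7 that by (simp add: nested jacobi pull)
    qed (use 7 in \<open>simp_all add: C(1) P_intros\<close>)
  next
    case (8 f g y)
    have "C (cnj \<circ> f) (cnj \<circ> g) y = - (cnj \<circ> C f g) y"
    proof (rule det[of _ "\<lambda>y. - (cnj \<circ> C f g) y"])
      show "C (cnj \<circ> f) (cnj \<circ> g) (F x) = - (cnj \<circ> C f g) (F x)" if "x \<in> X" for x
        using 8 that by (simp add: P_intros comp_assoc pull reality flip: C(2))
    qed (use 8 in \<open>simp_all add: C(1) P_intros del: o_apply\<close>)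
    then show ?case by simp
  qed
  then show ?thesis using C unfolding P_def by blast
qed

text \<open>
  If \<open>{f, h} = c f h\<close> at a point, then \<open>c\<close> is the value of \<open>{log f, log h}\<close>, which is why such
  constants are additive in both arguments.
\<close>

lemma scaling_mult:
  assumes "f \<in> A" "g \<in> A" "h \<in> A" "x \<in> X"
    and "B f h x = c * (f x * h x)" "B g h x = d * (g x * h x)"
  shows "B (\<lambda>y. f y * g y) h x = (c + d) * ((f x * g x) * h x)"
  using assms by (simp add: leibniz algebra_simps)

lemma scaling_mult_right:
  assumes "f \<in> A" "g \<in> A" "(\<lambda>y. f y * g y) \<in> A" "h \<in> A" "x \<in> X"
    and "B h f x = c * (h x * f x)" "B h g x = d * (h x * g x)"
  shows "B h (\<lambda>y. f y * g y) x = (c + d) * (h x * (f x * g x))"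
proof -
  have "B h (\<lambda>y. f y * g y) x = - B (\<lambda>y. f y * g y) h x" using assms by (intro antisym)
  also have "\<dots> = - (f x * B g h x + B f h x * g x)" using assms by (simp add: leibniz)
  also have "\<dots> = f x * B h g x + B h f x * g x" using assms antisym[of f h x] antisym[of g h x] by simp
  finally show ?thesis using assms by (simp add: algebra_simps)
qed

lemma scaling_swap:
  assumes "f \<in> A" "g \<in> A" "x \<in> X" "B f g x = c * (f x * g x)"
  shows "B g f x = (- c) * (g x * f x)"
  using antisym[of g f x] assms by simp

end


section \<open>The even sphere\<close>

lemma poly_funs_continuous:
  fixes X :: "'p::topological_space set"
  assumes "f \<in> poly_funs X G" and "\<And>g. g \<in> G \<Longrightarrow> continuous_on X g"
  shows "continuous_on X f"
  using assms(1)
proof induction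
  case (gen f) then show ?case by (rule assms(2))
next
  case (gen_cnj f) then show ?case unfolding o_def by (intro continuous_on_cnj assms(2))
next
  case (cong f g) then show ?case by (simp cong: continuous_on_cong_simp)
qed (auto intro: continuous_intros)

lemma poly_S2n_continuous: "f \<in> poly_S2n \<Longrightarrow> continuous_on S2n f"
  unfolding poly_S2n_def
proof (erule poly_funs_continuous)
  fix g :: "'a S2n_space \<Rightarrow> complex"
  assume "g \<in> range coord_a \<union> {coord_t}"
  then show "continuous_on S2n g"
    by (auto simp: coord_a_def[abs_def] coord_t_def[abs_def] intro!: continuous_intros)
qed

text \<open>
  The only point of the sphere with \<open>t \<le> 0\<close> is the origin.  It is the end point of an arc along
  which \<open>t\<close> is positive, so continuity takes care of it.
\<close>

lemma poly_S2n_determined: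
  fixes x :: "('n::finite) S2n_space"
  assumes f: "f \<in> poly_S2n" and g: "g \<in> poly_S2n" and x: "x \<in> S2n"
    and eq: "\<And>y. y \<in> S2n \<Longrightarrow> snd y > 0 \<Longrightarrow> f y = g y"
  shows "f x = g x"
proof (cases "snd x > 0")
  case True then show ?thesis using eq x by simp
next
  case False
  define i :: 'n where "i = undefined"
  \<comment> \<open>half a meridian, parametrized by \<open>t\<close>\<close>
  define \<gamma> :: "real \<Rightarrow> 'n S2n_space" where
    "\<gamma> e = ((\<chi> j. if j = i then of_real (sqrt (e * (1 - e))) else 0), e)" for e
  have norm: "(\<Sum>j\<in>UNIV. (cmod (fst x $ j))\<^sup>2) = snd x * (1 - snd x)"
    using x by (auto simp: S2n_def)
  then have "snd x * (1 - snd x) \<ge> 0" by (metis sum_nonneg zero_le_power2)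
  with False have t: "snd x = 0" by (auto simp: zero_le_mult_iff)
  with norm have "\<forall>j. fst x $ j = 0" by (simp add: sum_nonneg_eq_0_iff)
  with t have x0: "x = \<gamma> 0" by (simp add: \<gamma>_def prod_eq_iff vec_eq_iff)
  have mem: "\<gamma> e \<in> S2n" if "e \<in> {0..1}" for e
  proof -
    have "(\<Sum>j\<in>UNIV. (cmod (fst (\<gamma> e) $ j))\<^sup>2) = (\<Sum>j\<in>UNIV. if j = i then (sqrt (e * (1 - e)))\<^sup>2 else 0)"
      by (intro sum.cong) (auto simp: \<gamma>_def)
    also have "\<dots> = e * (1 - e)" using that by simp
    finally show ?thesis by (simp add: S2n_def \<gamma>_def)
  qed
  have "continuous_on {0..1} \<gamma>"
    unfolding \<gamma>_def
  proof (intro continuous_on_Pair continuous_on_vec_lambda)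
    show "continuous_on {0..1} (\<lambda>e. if j = i then complex_of_real (sqrt (e * (1 - e))) else 0)" for j
      by (cases "j = i") (auto intro!: continuous_intros)
  qed (rule continuous_on_id)
  then have comp: "continuous_on {0..1} (\<lambda>e. h (\<gamma> e))" if "h \<in> poly_S2n" for h
    by (rule continuous_on_compose2[OF poly_S2n_continuous[OF that]]) (use mem in blast)
  have cont: "continuous_on (closure {0<..1}) (\<lambda>e. f (\<gamma> e) - g (\<gamma> e))"
    using continuous_on_diff[OF comp[OF f] comp[OF g]] by simp
  have "f (\<gamma> e) - g (\<gamma> e) = 0" if "e \<in> {0<..1}" for e
    using eq[of "\<gamma> e"] mem[of e] that by (simp add: \<gamma>_def)
  from continuous_constant_on_closure[OF cont this, of 0] have "f (\<gamma> 0) - g (\<gamma> 0) = 0"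
    by simp
  then show ?thesis using x0 by simp
qed

section \<open>Telescoping along a finite linear order\<close>

text \<open>
  An element of a linear order need not come with a successor function; indexing by the sets
  \<open>{..<l}\<close> and \<open>{..l}\<close> makes the neighbouring terms match nevertheless.
\<close>

lemma sum_telescope_down_closed:
  fixes F :: "'a::{finite,linorder} set \<Rightarrow> 'b::ab_group_add"
  assumes "\<And>x y. y \<in> S \<Longrightarrow> x \<le> y \<Longrightarrow> x \<in> S"
  shows "(\<Sum>l\<in>S. F {..l} - F {..<l}) = F S - F {}"
proof -
  have "finite S" by simp
  then show ?thesis using assms
  proof (induction S rule: finite_linorder_max_induct)
    case (insert b S)
    have "S = {..<b}"
    proof (intro equalityI subsetI)
      show "x \<in> {..<b}" if "x \<in> S" for x using insert.hyps(2) that by simp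
      show "x \<in> S" if "x \<in> {..<b}" for x
      proof -
        have "x \<noteq> b" "x \<in> insert b S" using that insert.prems[OF insertI1, of x] by auto
        then show ?thesis by blast
      qed
    qed
    then have S: "{..<b} = S" "{..b} = insert b S" using ivl_disj_un_singleton(2)[of b] by simp_all
    have "b \<notin> S" using insert.hyps(2) by blast
    moreover have "(\<Sum>l\<in>S. F {..l} - F {..<l}) = F S - F {}"
    proof (rule insert.IH)
      show "x \<in> S" if "y \<in> S" "x \<le> y" for x y using that unfolding \<open>S = {..<b}\<close> by simp
    qed
    ultimately show ?case by (simp add: S)
  qed simp
qed

lemma prod_telescope_down_closed:
  fixes F :: "'a::{finite,linorder} set \<Rightarrow> 'b::field"
  assumes "\<And>x y. y \<in> S \<Longrightarrow> x \<le> y \<Longrightarrow> x \<in> S" and "\<And>S. F S \<noteq> 0"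
  shows "(\<Prod>l\<in>S. F {..<l} / F {..l}) = F {} / F S"
proof -
  have "finite S" by simp
  then show ?thesis using assms(1)
  proof (induction S rule: finite_linorder_max_induct)
    case (insert b S)
    have "S = {..<b}"
    proof (intro equalityI subsetI)
      show "x \<in> {..<b}" if "x \<in> S" for x using insert.hyps(2) that by simp
      show "x \<in> S" if "x \<in> {..<b}" for x
      proof -
        have "x \<noteq> b" "x \<in> insert b S" using that insert.prems[OF insertI1, of x] by auto
        then show ?thesis by blast
      qed
    qed
    then have S: "{..<b} = S" "{..b} = insert b S" using ivl_disj_un_singleton(2)[of b] by simp_all
    have "b \<notin> S" using insert.hyps(2) by blast
    moreover have "(\<Prod>l\<in>S. F {..<l} / F {..l}) = F {} / F S"
    proof (rule insert.IH)
      show "x \<in> S" if "y \<in> S" "x \<le> y" for x y using that unfolding \<open>S = {..<b}\<close> by simp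
    qed
    ultimately show ?case using assms(2) by (simp add: S)
  qed (simp add: assms(2))
qed

section \<open>The map onto the even sphere\<close>

text \<open>The exponents of \<open>a\<^sub>i\<close> in terms of the \<open>\<tau>\<^sub>j\<^sup>1\<^sup>/\<^sup>2\<close>, which are natural numbers.\<close>

definition twice_M :: "'n::linorder \<Rightarrow> 'n \<Rightarrow> nat" where
  "twice_M i j = (if i = j then 0 else if i < j then 2 else 1)"

lemma M_eq_half_twice_M: "M $ i $ j = real (twice_M i j) / 2"
  by (simp add: M_def twice_M_def)

lemma powr_half_power: "x > 0 \<Longrightarrow> x powr (real n / 2) = sqrt x ^ n"
  by (simp add: powr_power powr_half_sqrt[symmetric])

lemma powr_half_power_sq:
  assumes "x > 0 \<or> x = 0 \<and> n \<noteq> 0"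
  shows "(x powr (real n / 2))\<^sup>2 = x ^ n"
proof (cases "x > 0")
  case True
  have "(sqrt x ^ n)\<^sup>2 = ((sqrt x)\<^sup>2) ^ n" by (simp only: power_mult[symmetric] mult.commute)
  then show ?thesis using True by (simp add: powr_half_power)
next
  case False
  then show ?thesis using assms by simp
qed

text \<open>
  This interpolates between \<open>t\<^sup>2\<close> for \<open>S = {}\<close> and \<open>t\<close> for \<open>S = UNIV\<close>; adding an index \<open>i\<close> to the set
  of its predecessors increases it by \<open>|a\<^sub>i|\<^sup>2\<close>.
\<close>

definition weight :: "('n::finite) S2_prod_space \<Rightarrow> 'n set \<Rightarrow> real" where
  "weight p S = (\<Prod>j\<in>UNIV. if j \<in> S then snd (p $ j) else (snd (p $ j))\<^sup>2)"

lemma weight_UNIV: "weight p UNIV = snd (Phi p)"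
  by (simp add: weight_def Phi_def)

lemma weight_empty: "weight p {} = (snd (Phi p))\<^sup>2"
  by (simp add: weight_def Phi_def prod_power_distrib)

lemma weight_split:
  assumes "S = {..<i} \<or> S = {..i}"
  shows "weight p S = (if i \<in> S then snd (p $ i) else (snd (p $ i))\<^sup>2)
    * (\<Prod>j\<in>UNIV. snd (p $ j) ^ twice_M i j)"
proof -
  have "(if j \<in> S then snd (p $ j) else (snd (p $ j))\<^sup>2) = snd (p $ j) ^ twice_M i j"
    if "j \<in> UNIV - {i}" for j
  proof -
    have "j < i \<or> i < j" using that by auto
    then show ?thesis using assms by (auto simp: twice_M_def)
  qed
  then have "(\<Prod>j\<in>UNIV - {i}. if j \<in> S then snd (p $ j) else (snd (p $ j))\<^sup>2)
      = (\<Prod>j\<in>UNIV - {i}. snd (p $ j) ^ twice_M i j)"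
    by (rule prod.cong[OF refl])
  moreover have "snd (p $ i) ^ twice_M i i = 1" by (simp add: twice_M_def)
  ultimately show ?thesis
    unfolding weight_def by (simp only: prod.remove[OF finite UNIV_I[of i]] mult_1)
qed

lemma weight_lessThan:
  "weight p {..<i} = (snd (p $ i))\<^sup>2 * (\<Prod>j\<in>UNIV. snd (p $ j) ^ twice_M i j)"
  by (subst weight_split[of _ i]) auto

lemma weight_atMost:
  "weight p {..i} = snd (p $ i) * (\<Prod>j\<in>UNIV. snd (p $ j) ^ twice_M i j)"
  by (subst weight_split[of _ i]) auto

lemma S2_prodD: "p \<in> S2_prod \<Longrightarrow> (cmod (fst (p $ i)))\<^sup>2 = snd (p $ i) * (1 - snd (p $ i))"
  by (auto simp: S2_prod_def S2_def split: prod.splits)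

lemma S2_prod_nonneg:
  assumes "p \<in> S2_prod" shows "snd (p $ i) \<ge> 0"
proof -
  have "snd (p $ i) * (1 - snd (p $ i)) \<ge> 0" using S2_prodD[OF assms, of i] by (metis zero_le_power2)
  then show ?thesis by (auto simp: zero_le_mult_iff)
qed

text \<open>
  Both sides equal \<open>\<tau>\<^sub>i (1 - \<tau>\<^sub>i)\<close> times the product of the \<open>\<tau>\<^sub>j\<^bsup>2 M\<^sub>i\<^sub>j\<^esup>\<close>.
\<close>

lemma cmod_Phi_sq:
  assumes p: "p \<in> S2_prod"
  shows "(cmod (fst (Phi p) $ i))\<^sup>2 = weight p {..i} - weight p {..<i}"
proof (cases "snd (p $ i) = 0")
  case True
  \<comment> \<open>The \<open>i\<close>-th factor is \<open>0 powr 0 = 0\<close> here instead of \<open>1\<close>, which is harmless as \<open>\<alpha>\<^sub>i = 0\<close>.\<close>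
  then show ?thesis using S2_prodD[OF p, of i] by (simp add: Phi_def weight_lessThan weight_atMost)
next
  case False
  have "(\<Prod>k\<in>UNIV. snd (p $ k) powr (M $ i $ k))\<^sup>2 = (\<Prod>k\<in>UNIV. snd (p $ k) ^ twice_M i k)"
    unfolding prod_power_distrib M_eq_half_twice_M
  proof (intro prod.cong powr_half_power_sq)
    fix k
    show "0 < snd (p $ k) \<or> snd (p $ k) = 0 \<and> twice_M i k \<noteq> 0"
      using False S2_prod_nonneg[OF p, of k] by (cases "k = i") (auto simp: twice_M_def)
  qed simp
  moreover have "fst (Phi p) $ i = fst (p $ i) * of_real (\<Prod>k\<in>UNIV. snd (p $ k) powr (M $ i $ k))"
    by (simp add: Phi_def)
  ultimately have "(cmod (fst (Phi p) $ i))\<^sup>2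
      = snd (p $ i) * (1 - snd (p $ i)) * (\<Prod>k\<in>UNIV. snd (p $ k) ^ twice_M i k)"
    by (simp only: norm_mult norm_of_real power_mult_distrib power2_abs S2_prodD[OF p])
  then show ?thesis by (simp add: weight_lessThan weight_atMost algebra_simps power2_eq_square)
qed

lemma sum_cmod_Phi_sq:
  assumes "p \<in> S2_prod" "\<And>x y. y \<in> S \<Longrightarrow> x \<le> y \<Longrightarrow> x \<in> S"
  shows "(\<Sum>l\<in>S. (cmod (fst (Phi p) $ l))\<^sup>2) = weight p S - (snd (Phi p))\<^sup>2"
  using sum_telescope_down_closed[of S "weight p"] assms by (simp add: cmod_Phi_sq weight_empty)

lemma Phi_mem: "p \<in> S2_prod \<Longrightarrow> Phi p \<in> S2n"
  using sum_cmod_Phi_sq[of p UNIV]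
  by (auto simp: S2n_def weight_UNIV algebra_simps power2_eq_square split: prod.splits)

text \<open>
  The preimage is forced: \<open>weight p {..<k}\<close> must be \<open>Q {..<k}\<close> below, and the quotient of
  \<open>weight p {..<k}\<close> by \<open>weight p {..k}\<close> is \<open>\<tau>\<^sub>k\<close>.  The products of these quotients telescope, which
  gives \<open>t\<close> for the product of all of them, and \<open>|\<alpha>\<^sub>k|\<^sup>2 = \<tau>\<^sub>k (1 - \<tau>\<^sub>k)\<close>.
\<close>

lemma Phi_surj:
  fixes x :: "('n::{finite,linorder}) S2n_space"
  assumes x: "x \<in> S2n" and pos: "snd x > 0"
  shows "\<exists>p\<in>S2_prod_pos. Phi p = x"
proof -
  define t where "t = snd x"
  define Q where "Q S = t\<^sup>2 + (\<Sum>l\<in>S. (cmod (fst x $ l))\<^sup>2)" for S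
  define \<tau> where "\<tau> k = Q {..<k} / Q {..k}" for k
  define c where "c k = (\<Prod>j\<in>UNIV. \<tau> j powr (M $ k $ j))" for k
  define p :: "'n S2_prod_space" where "p = (\<chi> k. (fst x $ k / of_real (c k), \<tau> k))"
  have t: "t > 0" using pos by (simp add: t_def)
  have Q: "Q S > 0" for S unfolding Q_def by (intro add_pos_nonneg sum_nonneg) (use t in simp_all)
  then have Q0: "Q S \<noteq> 0" for S by (metis less_irrefl)
  have \<tau>: "\<tau> k > 0" for k unfolding \<tau>_def using Q by simp
  have c: "c k > 0" for k unfolding c_def using \<tau> by (intro prod_pos) (simp add: less_imp_neq[symmetric])
  have Q_UNIV: "Q UNIV = t"
    using x by (auto simp: Q_def t_def S2n_def algebra_simps power2_eq_square)
  have Q_empty: "Q {} = t\<^sup>2" by (simp add: Q_def)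
  have Q_step: "Q {..k} = Q {..<k} + (cmod (fst x $ k))\<^sup>2" for k
  proof -
    have "{..k} = insert k {..<k}" by auto
    then show ?thesis by (simp add: Q_def)
  qed
  have prod_all: "(\<Prod>j\<in>UNIV. \<tau> j) = t"
    using prod_telescope_down_closed[of UNIV Q] Q0 t
    by (simp add: \<tau>_def Q_UNIV Q_empty power2_eq_square)
  have prod_less: "(\<Prod>j\<in>{..<k}. \<tau> j) = t\<^sup>2 / Q {..<k}" for k
    using prod_telescope_down_closed[of "{..<k}" Q] Q0 by (simp add: \<tau>_def Q_empty)
  have prod_le: "(\<Prod>j\<in>{..k}. \<tau> j) = t\<^sup>2 / Q {..k}" for k
    using prod_telescope_down_closed[of "{..k}" Q] Q0 by (simp add: \<tau>_def Q_empty)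
  have prod_greater: "(\<Prod>j\<in>{k<..}. \<tau> j) = Q {..k} / t" for k
  proof -
    have "UNIV = {..k} \<union> {k<..}" by auto
    then have "t = (\<Prod>j\<in>{..k}. \<tau> j) * (\<Prod>j\<in>{k<..}. \<tau> j)"
      using prod_all by (subst prod.union_disjoint[symmetric]) auto
    then show ?thesis using t Q[of "{..k}"] by (simp add: prod_le field_simps power2_eq_square)
  qed
  have c_sq: "(c k)\<^sup>2 = (Q {..k})\<^sup>2 / Q {..<k}" for k
  proof -
    have "(c k)\<^sup>2 = (\<Prod>j\<in>UNIV. \<tau> j ^ twice_M k j)"
      unfolding c_def prod_power_distrib M_eq_half_twice_M
      by (intro prod.cong powr_half_power_sq) (simp_all add: \<tau>)
    also have "UNIV = {..k} \<union> {k<..}" by auto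
    also have "(\<Prod>j\<in>{..k} \<union> {k<..}. \<tau> j ^ twice_M k j)
        = (\<Prod>j\<in>{..k}. \<tau> j ^ twice_M k j) * (\<Prod>j\<in>{k<..}. \<tau> j ^ twice_M k j)"
      by (intro prod.union_disjoint) auto
    also have "{..k} = insert k {..<k}" by auto
    also have "(\<Prod>j\<in>insert k {..<k}. \<tau> j ^ twice_M k j) = (\<Prod>j\<in>{..<k}. \<tau> j)"
      by (simp add: twice_M_def[of k k]) (auto intro!: prod.cong simp: twice_M_def)
    also have "(\<Prod>j\<in>{k<..}. \<tau> j ^ twice_M k j) = (\<Prod>j\<in>{k<..}. \<tau> j)\<^sup>2"
      unfolding prod_power_distrib by (intro prod.cong) (auto simp: twice_M_def)
    finally show ?thesis using t by (simp add: prod_less prod_greater power_divide)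
  qed
  have "(cmod (fst x $ k / of_real (c k)))\<^sup>2 = \<tau> k * (1 - \<tau> k)" for k
  proof -
    have "(cmod (fst x $ k / of_real (c k)))\<^sup>2 = (Q {..k} - Q {..<k}) / (c k)\<^sup>2"
      by (simp add: norm_divide power_divide Q_step)
    also have "\<dots> = \<tau> k * (1 - \<tau> k)"
      using Q[of "{..k}"] Q[of "{..<k}"] unfolding c_sq \<tau>_def
      by (simp add: field_simps power2_eq_square)
    finally show ?thesis .
  qed
  then have "p \<in> S2_prod_pos"
    using \<tau> by (simp add: S2_prod_pos_def S2_prod_def S2_def p_def)
  moreover have "Phi p = x"
  proof -
    have "fst x $ k / of_real (c k) * of_real (\<Prod>j\<in>UNIV. \<tau> j powr (M $ k $ j)) = fst x $ k" for k
      unfolding c_def[symmetric] using c[of k] by simp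
    then show ?thesis
      by (simp add: Phi_def p_def prod_eq_iff vec_eq_iff prod_all t_def del: of_real_prod)
  qed
  ultimately show ?thesis by blast
qed


section \<open>Brackets of monomials\<close>

lemma half_poly_const: "(\<lambda>_. c) \<in> half_poly_S2_prod"
  unfolding half_poly_S2_prod_def by (rule poly_funs.const)

lemma half_poly_mult:
  "f \<in> half_poly_S2_prod \<Longrightarrow> g \<in> half_poly_S2_prod \<Longrightarrow> (\<lambda>p. f p * g p) \<in> half_poly_S2_prod"
  unfolding half_poly_S2_prod_def by (rule poly_funs.mult)

lemma half_poly_power: "f \<in> half_poly_S2_prod \<Longrightarrow> (\<lambda>p. f p ^ n) \<in> half_poly_S2_prod"
  unfolding half_poly_S2_prod_def by (rule poly_funs_power)

lemma half_poly_cnj: "f \<in> half_poly_S2_prod \<Longrightarrow> cnj \<circ> f \<in> half_poly_S2_prod"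
  unfolding half_poly_S2_prod_def by (rule poly_funs_cnj)

lemma half_poly_prod:
  "finite I \<Longrightarrow> (\<And>i. i \<in> I \<Longrightarrow> f i \<in> half_poly_S2_prod) \<Longrightarrow> (\<lambda>p. \<Prod>i\<in>I. f i p) \<in> half_poly_S2_prod"
  by (induction I rule: finite_induct) (simp_all add: half_poly_const half_poly_mult)

definition sqrt_tau_monomial :: "('n::finite \<Rightarrow> nat) \<Rightarrow> 'n S2_prod_space \<Rightarrow> complex" where
  "sqrt_tau_monomial e p = (\<Prod>j\<in>UNIV. sqrt_tau j p ^ e j)"

definition alpha_monomial :: "'n::finite \<Rightarrow> ('n \<Rightarrow> nat) \<Rightarrow> 'n S2_prod_space \<Rightarrow> complex" where
  "alpha_monomial i e p = alpha i p * sqrt_tau_monomial e p"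

lemma sqrt_tau_monomial_mem: "sqrt_tau_monomial e \<in> half_poly_S2_prod"
  unfolding sqrt_tau_monomial_def[abs_def] by (intro half_poly_prod half_poly_power half_poly_gens) simp

lemma alpha_monomial_mem: "alpha_monomial i e \<in> half_poly_S2_prod"
  unfolding alpha_monomial_def[abs_def] by (intro half_poly_mult half_poly_gens sqrt_tau_monomial_mem)

lemma cnj_sqrt_tau_monomial: "cnj (sqrt_tau_monomial e p) = sqrt_tau_monomial e p"
  by (simp add: sqrt_tau_monomial_def sqrt_tau_def)

lemma cnj_alpha_monomial:
  "cnj \<circ> alpha_monomial i e = (\<lambda>p. (cnj \<circ> alpha i) p * sqrt_tau_monomial e p)"
  by (simp add: fun_eq_iff alpha_monomial_def cnj_sqrt_tau_monomial)

lemma sqrt_tau_sq: "p \<in> S2_prod_pos \<Longrightarrow> tau i p = sqrt_tau i p * sqrt_tau i p"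
  by (auto simp: S2_prod_pos_def tau_def sqrt_tau_def less_imp_le simp flip: of_real_mult)

lemma sqrt_tau_nonzero: "p \<in> S2_prod_pos \<Longrightarrow> sqrt_tau i p \<noteq> 0"
  by (auto simp: S2_prod_pos_def sqrt_tau_def dest: spec[of _ i])

context standard_product_bracket
begin

text \<open>
  Since \<open>\<tau> = \<tau>\<^sup>1\<^sup>/\<^sup>2 \<cdot> \<tau>\<^sup>1\<^sup>/\<^sup>2\<close> with a non-zero factor, scaling constants are halved on passing to
  the root.
\<close>

lemma sqrt_tau_scaling:
  assumes f: "f \<in> half_poly_S2_prod" and p: "p \<in> S2_prod_pos"
    and "B (tau j) f p = (2 * c) * (tau j p * f p)"
  shows "B (sqrt_tau j) f p = c * (sqrt_tau j p * f p)"
proof -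
  have "B (tau j) f p = B (\<lambda>q. sqrt_tau j q * sqrt_tau j q) f p"
    by (rule respects) (simp_all add: f p half_poly_mult sqrt_tau_sq)
  also have "\<dots> = 2 * sqrt_tau j p * B (sqrt_tau j) f p"
    using f p by (simp add: leibniz)
  finally have e: "B (tau j) f p = 2 * sqrt_tau j p * B (sqrt_tau j) f p" .
  have "2 * sqrt_tau j p * B (sqrt_tau j) f p = 2 * sqrt_tau j p * (c * (sqrt_tau j p * f p))"
    unfolding e[symmetric] assms(3) sqrt_tau_sq[OF p] by (simp only: mult_ac)
  then show ?thesis using sqrt_tau_nonzero[OF p, of j] by simp
qed

lemma sqrt_tau_alpha:
  assumes p: "p \<in> S2_prod_pos"
  shows "B (sqrt_tau j) (alpha i) p = (if j = i then 1 else 0) * (sqrt_tau j p * alpha i p)"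
proof (rule sqrt_tau_scaling)
  show "B (tau j) (alpha i) p = (2 * (if j = i then 1 else 0)) * (tau j p * alpha i p)"
    using antisym[of "tau j" "alpha i" p] p by (simp add: alpha_tau)
qed (use p in simp_all)

lemma sqrt_tau_cnj_alpha:
  assumes p: "p \<in> S2_prod_pos"
  shows "B (sqrt_tau j) (cnj \<circ> alpha i) p = (if j = i then - 1 else 0) * (sqrt_tau j p * (cnj \<circ> alpha i) p)"
proof (rule sqrt_tau_scaling)
  have "cnj \<circ> tau j = tau j" by (simp add: tau_def fun_eq_iff)
  then have "B (tau j) (cnj \<circ> alpha i) p = - cnj (B (tau j) (alpha i) p)"
    using reality[of "tau j" "alpha i" p] p by simp
  then show "B (tau j) (cnj \<circ> alpha i) p = (2 * (if j = i then - 1 else 0)) * (tau j p * (cnj \<circ> alpha i) p)"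
    using antisym[of "tau j" "alpha i" p] p by (simp add: alpha_tau tau_def)
qed (use p in \<open>simp_all add: half_poly_cnj\<close>)

lemma sqrt_tau_sqrt_tau:
  assumes p: "p \<in> S2_prod_pos"
  shows "B (sqrt_tau j) (sqrt_tau i) p = 0 * (sqrt_tau j p * sqrt_tau i p)"
proof (rule sqrt_tau_scaling)
  have "B (sqrt_tau i) (tau j) p = 0 * (sqrt_tau i p * tau j p)"
  proof (rule sqrt_tau_scaling)
    show "B (tau i) (tau j) p = (2 * 0) * (tau i p * tau j p)"
      using p by (cases "i = j") (simp_all add: tau_tau self_zero)
  qed (use p in simp_all)
  then show "B (tau j) (sqrt_tau i) p = (2 * 0) * (tau j p * sqrt_tau i p)"
    using antisym[of "tau j" "sqrt_tau i" p] p by simp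
qed (use p in simp_all)

lemma scaling_power:
  assumes f: "f \<in> half_poly_S2_prod" and h: "h \<in> half_poly_S2_prod" and p: "p \<in> S2_prod_pos"
    and "B f h p = c * (f p * h p)"
  shows "B (\<lambda>q. f q ^ n) h p = (of_nat n * c) * (f p ^ n * h p)"
proof (induction n)
  case 0
  then show ?case using const_zero[OF half_poly_const h p] by simp
next
  case (Suc n)
  have "B (\<lambda>q. f q * f q ^ n) h p = (c + of_nat n * c) * ((f p * f p ^ n) * h p)"
    by (rule scaling_mult) (use assms Suc in \<open>simp_all add: half_poly_power\<close>)
  then show ?case by (simp add: algebra_simps)
qed

lemma scaling_prod:
  assumes h: "h \<in> half_poly_S2_prod" and p: "p \<in> S2_prod_pos" and "finite I"
    and "\<And>i. i \<in> I \<Longrightarrow> f i \<in> half_poly_S2_prod"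
    and "\<And>i. i \<in> I \<Longrightarrow> B (f i) h p = c i * (f i p * h p)"
  shows "B (\<lambda>q. \<Prod>i\<in>I. f i q) h p = (\<Sum>i\<in>I. c i) * ((\<Prod>i\<in>I. f i p) * h p)"
  using \<open>finite I\<close> assms(4,5)
proof (induction I rule: finite_induct)
  case empty
  then show ?case using const_zero[OF half_poly_const h p] by simp
next
  case (insert i I)
  have "B (\<lambda>q. f i q * (\<Prod>i\<in>I. f i q)) h p
      = (c i + (\<Sum>i\<in>I. c i)) * ((f i p * (\<Prod>i\<in>I. f i p)) * h p)"
    by (rule scaling_mult) (use insert h p in \<open>simp_all add: half_poly_prod\<close>)
  then show ?case using insert.hyps by simp
qed

lemma sqrt_tau_monomial_scaling:
  assumes "h \<in> half_poly_S2_prod" "p \<in> S2_prod_pos"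
    and "\<And>j. B (sqrt_tau j) h p = c j * (sqrt_tau j p * h p)"
  shows "B (sqrt_tau_monomial e) h p = (\<Sum>j\<in>UNIV. of_nat (e j) * c j) * (sqrt_tau_monomial e p * h p)"
  unfolding sqrt_tau_monomial_def[abs_def]
  by (rule scaling_prod) (use assms in \<open>simp_all add: half_poly_power scaling_power\<close>)

lemma sqrt_tau_monomial_alpha:
  assumes p: "p \<in> S2_prod_pos"
  shows "B (sqrt_tau_monomial e) (alpha i) p = of_nat (e i) * (sqrt_tau_monomial e p * alpha i p)"
proof -
  have "(\<Sum>j\<in>UNIV. of_nat (e j) * (if j = i then 1 else 0)) = (of_nat (e i) :: complex)"
    by (simp add: if_distrib[of "\<lambda>x. _ * x"] cong: if_cong)
  then show ?thesis
    using sqrt_tau_monomial_scaling[OF half_poly_gens(1) p sqrt_tau_alpha[OF p], of e] by simp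
qed

lemma sqrt_tau_monomial_cnj_alpha:
  assumes p: "p \<in> S2_prod_pos"
  shows "B (sqrt_tau_monomial e) (cnj \<circ> alpha i) p
    = (- of_nat (e i)) * (sqrt_tau_monomial e p * (cnj \<circ> alpha i) p)"
proof -
  have "(\<Sum>j\<in>UNIV. of_nat (e j) * (if j = i then - 1 else 0)) = (- of_nat (e i) :: complex)"
    by (simp add: if_distrib[of "\<lambda>x. _ * x"] cong: if_cong)
  then show ?thesis
    using sqrt_tau_monomial_scaling[OF half_poly_cnj[OF half_poly_gens(1)] p sqrt_tau_cnj_alpha[OF p], of e]
    by simp
qed

lemma sqrt_tau_monomials:
  assumes p: "p \<in> S2_prod_pos"
  shows "B (sqrt_tau_monomial d) (sqrt_tau_monomial e) p = 0 * (sqrt_tau_monomial d p * sqrt_tau_monomial e p)"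
proof -
  have "B (sqrt_tau_monomial e) (sqrt_tau j) p = 0" for j
    using sqrt_tau_monomial_scaling[OF half_poly_gens(3) p sqrt_tau_sqrt_tau[OF p], of e j] by simp
  then have "B (sqrt_tau j) (sqrt_tau_monomial e) p = 0 * (sqrt_tau j p * sqrt_tau_monomial e p)" for j
    using antisym[OF half_poly_gens(3) sqrt_tau_monomial_mem p, of j e] by simp
  then show ?thesis
    using sqrt_tau_monomial_scaling[OF sqrt_tau_monomial_mem p, of e "\<lambda>_. 0" d] by simp
qed

lemma alpha_monomial_sqrt_tau_monomial:
  assumes p: "p \<in> S2_prod_pos"
  shows "B (alpha_monomial i e) (sqrt_tau_monomial d) p
    = (- of_nat (d i)) * (alpha_monomial i e p * sqrt_tau_monomial d p)"
proof -
  have "B (alpha i) (sqrt_tau_monomial d) p = (- of_nat (d i)) * (alpha i p * sqrt_tau_monomial d p)"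
    by (rule scaling_swap) (use p in \<open>simp_all add: sqrt_tau_monomial_mem sqrt_tau_monomial_alpha\<close>)
  then have "B (\<lambda>q. alpha i q * sqrt_tau_monomial e q) (sqrt_tau_monomial d) p
      = (- of_nat (d i) + 0) * ((alpha i p * sqrt_tau_monomial e p) * sqrt_tau_monomial d p)"
    by (intro scaling_mult sqrt_tau_monomials half_poly_gens sqrt_tau_monomial_mem p)
  then show ?thesis by (simp add: alpha_monomial_def[abs_def])
qed

lemma alpha_monomial_scaling:
  assumes h: "h \<in> half_poly_S2_prod" and p: "p \<in> S2_prod_pos"
    and "B (alpha i) h p = c * (alpha i p * h p)"
    and "B (sqrt_tau_monomial e) h p = d * (sqrt_tau_monomial e p * h p)"
  shows "B (alpha_monomial i e) h p = (c + d) * (alpha_monomial i e p * h p)"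
  unfolding alpha_monomial_def[abs_def]
  by (rule scaling_mult[OF half_poly_gens(1) sqrt_tau_monomial_mem h p assms(3,4)])

text \<open>
  In the next two lemmas only \<open>\<alpha>\<^sub>i\<close> with the factor \<open>\<tau>\<^sub>i\<^sup>1\<^sup>/\<^sup>2\<close> of the second monomial, and \<open>\<alpha>\<^sub>j\<close> (or
  its conjugate) with the factor \<open>\<tau>\<^sub>j\<^sup>1\<^sup>/\<^sup>2\<close> of the first, have a non-zero bracket; conjugating
  \<open>\<alpha>\<^sub>j\<close> changes the sign of the latter.
\<close>

lemma alpha_monomials:
  assumes p: "p \<in> S2_prod_pos" and "i \<noteq> j"
  shows "B (alpha_monomial i e) (alpha_monomial j d) p
    = (of_nat (e j) - of_nat (d i)) * (alpha_monomial i e p * alpha_monomial j d p)"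
proof -
  have "B (alpha_monomial i e) (alpha j) p = (0 + of_nat (e j)) * (alpha_monomial i e p * alpha j p)"
    using assms by (intro alpha_monomial_scaling sqrt_tau_monomial_alpha) (simp_all add: alpha_alpha)
  then have "B (alpha_monomial i e) (\<lambda>q. alpha j q * sqrt_tau_monomial d q) p
      = ((0 + of_nat (e j)) + (- of_nat (d i))) * (alpha_monomial i e p * (alpha j p * sqrt_tau_monomial d p))"
    by (intro scaling_mult_right alpha_monomial_sqrt_tau_monomial half_poly_gens half_poly_mult
        sqrt_tau_monomial_mem alpha_monomial_mem p)
  then show ?thesis by (simp add: alpha_monomial_def[of j, abs_def])
qed

lemma alpha_monomial_cnj:
  assumes p: "p \<in> S2_prod_pos" and "i \<noteq> j"
  shows "B (alpha_monomial i e) (cnj \<circ> alpha_monomial j d) p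
    = (- of_nat (e j) - of_nat (d i)) * (alpha_monomial i e p * cnj (alpha_monomial j d p))"
proof -
  have "B (alpha_monomial i e) (cnj \<circ> alpha j) p
      = (0 + (- of_nat (e j))) * (alpha_monomial i e p * (cnj \<circ> alpha j) p)"
    using assms
    by (intro alpha_monomial_scaling sqrt_tau_monomial_cnj_alpha)
       (simp_all add: alpha_cnj_alpha half_poly_cnj)
  then have "B (alpha_monomial i e) (\<lambda>q. (cnj \<circ> alpha j) q * sqrt_tau_monomial d q) p
      = ((0 + (- of_nat (e j))) + (- of_nat (d i)))
        * (alpha_monomial i e p * ((cnj \<circ> alpha j) p * sqrt_tau_monomial d p))"
    by (intro scaling_mult_right alpha_monomial_sqrt_tau_monomial half_poly_gens half_poly_mult
        half_poly_cnj sqrt_tau_monomial_mem alpha_monomial_mem p)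
  then show ?thesis
    unfolding cnj_alpha_monomial by (simp add: alpha_monomial_def[of j] cnj_sqrt_tau_monomial)
qed

text \<open>
  As \<open>\<tau>\<^sub>i\<close> does not occur in the monomial \<open>w\<close> of the \<open>\<tau>\<^sub>j\<^sup>1\<^sup>/\<^sup>2\<close>, it commutes with \<open>\<alpha>\<^sub>i\<close> and its
  conjugate, so \<open>{\<alpha>\<^sub>i w, \<alpha>\<^sub>i\<^sup>* w} = w\<^sup>2 {\<alpha>\<^sub>i, \<alpha>\<^sub>i\<^sup>*}\<close>.
\<close>

lemma alpha_monomial_cnj_self:
  assumes p: "p \<in> S2_prod_pos" and e: "e i = 0"
  shows "B (alpha_monomial i e) (cnj \<circ> alpha_monomial i e) p
    = 2 * ((tau i p)\<^sup>2 * (sqrt_tau_monomial e p)\<^sup>2 - alpha_monomial i e p * cnj (alpha_monomial i e p))"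
proof -
  let ?w = "sqrt_tau_monomial e" and ?b = "cnj \<circ> alpha_monomial i e"
  have mem: "?w \<in> half_poly_S2_prod" "?b \<in> half_poly_S2_prod" "cnj \<circ> alpha i \<in> half_poly_S2_prod"
    by (simp_all add: sqrt_tau_monomial_mem half_poly_cnj alpha_monomial_mem)
  have w_cnj: "B (cnj \<circ> alpha i) ?w p = 0" and w_alpha: "B (alpha i) ?w p = 0"
    using sqrt_tau_monomial_cnj_alpha[OF p, of e i] sqrt_tau_monomial_alpha[OF p, of e i] e
      antisym[OF mem(3,1) p] antisym[OF half_poly_gens(1) mem(1) p, of i] by simp_all
  have b_w: "B ?b ?w p = 0"
    unfolding cnj_alpha_monomial using sqrt_tau_monomials[OF p, of e e] w_cnj
    by (subst leibniz) (simp_all add: mem p)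
  have b_alpha: "B ?b (alpha i) p = - B (alpha i) (cnj \<circ> alpha i) p * ?w p"
    unfolding cnj_alpha_monomial
    using antisym[OF mem(1) half_poly_gens(1) p, of i] w_alpha antisym[OF mem(3) half_poly_gens(1) p, of i]
    by (subst leibniz) (simp_all add: mem p)
  have "B (\<lambda>q. alpha i q * ?w q) ?b p = alpha i p * B ?w ?b p + B (alpha i) ?b p * ?w p"
    by (intro leibniz half_poly_gens mem p)
  then have "B (alpha_monomial i e) ?b p = (?w p)\<^sup>2 * B (alpha i) (cnj \<circ> alpha i) p"
    using b_w b_alpha antisym[OF mem(1,2) p] antisym[OF half_poly_gens(1) mem(2) p, of i]
    by (simp add: alpha_monomial_def[abs_def] power2_eq_square)
  then show ?thesis
    using p by (simp add: alpha_cnj_alpha alpha_monomial_def cnj_sqrt_tau_monomial algebra_simps power2_eq_square)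
qed

end

section \<open>The coinduced brackets\<close>

lemma coord_a_Phi:
  assumes "p \<in> S2_prod_pos"
  shows "(coord_a i \<circ> Phi) p = alpha_monomial i (twice_M i) p"
proof -
  have "snd (p $ k) powr (M $ i $ k) = sqrt (snd (p $ k)) ^ twice_M i k" for k
    unfolding M_eq_half_twice_M using assms by (intro powr_half_power) (simp add: S2_prod_pos_def)
  then show ?thesis
    by (simp add: coord_a_def Phi_def alpha_monomial_def sqrt_tau_monomial_def alpha_def sqrt_tau_def)
qed

lemma coord_t_Phi:
  assumes "p \<in> S2_prod_pos"
  shows "(coord_t \<circ> Phi) p = sqrt_tau_monomial (\<lambda>_. 2) p"
proof -
  have "(sqrt (snd (p $ k)))\<^sup>2 = snd (p $ k)" for k
    using assms by (simp add: S2_prod_pos_def less_imp_le)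
  then show ?thesis
    by (simp add: coord_t_def Phi_def sqrt_tau_monomial_def sqrt_tau_def flip: of_real_power)
qed

lemma Phi_mem_pos: "p \<in> S2_prod_pos \<Longrightarrow> Phi p \<in> S2n"
  by (intro Phi_mem) (simp add: S2_prod_pos_def)

lemma poly_S2n_comp_Phi: "f \<in> poly_S2n \<Longrightarrow> f \<circ> Phi \<in> half_poly_S2_prod"
  unfolding poly_S2n_def
proof (induction rule: poly_funs.induct)
  have gens: "g \<circ> Phi \<in> half_poly_S2_prod" if "g \<in> range coord_a \<union> {coord_t}"
    for g :: "'a S2n_space \<Rightarrow> complex"
  proof -
    have "coord_a i \<circ> Phi \<in> half_poly_S2_prod" for i :: 'a
      using poly_funs.cong[OF alpha_monomial_mem[unfolded half_poly_S2_prod_def] coord_a_Phi]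
      unfolding half_poly_S2_prod_def .
    moreover have "coord_t \<circ> Phi \<in> half_poly_S2_prod"
      using poly_funs.cong[OF sqrt_tau_monomial_mem[unfolded half_poly_S2_prod_def] coord_t_Phi]
      unfolding half_poly_S2_prod_def .
    ultimately show ?thesis using that by blast
  qed
  {
    case (gen f) then show ?case by (rule gens)
  next
    case (gen_cnj f) then show ?case unfolding comp_assoc by (intro half_poly_cnj gens)
  }
next
  case (const c) show ?case by (simp add: comp_ops half_poly_const)
next
  case (add f g)
  then show ?case unfolding comp_ops half_poly_S2_prod_def by (rule_tac poly_funs.add)
next
  case (mult f g) then show ?case unfolding comp_ops by (rule_tac half_poly_mult)
next
  case (cong f g)
  then have "(g \<circ> Phi) p = (f \<circ> Phi) p" if "p \<in> S2_prod_pos" for p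
    using Phi_mem_pos[OF that] by simp
  from poly_funs.cong[OF cong(3)[unfolded half_poly_S2_prod_def] this] show ?case
    unfolding half_poly_S2_prod_def .
qed

lemma poly_S2n_determined_by_Phi:
  assumes "f \<in> poly_S2n" "g \<in> poly_S2n" "x \<in> S2n"
    and "\<And>p. p \<in> S2_prod_pos \<Longrightarrow> f (Phi p) = g (Phi p)"
  shows "f x = g x"
proof (rule poly_S2n_determined)
  show "f y = g y" if "y \<in> S2n" "snd y > 0" for y
    using Phi_surj[OF that] assms(4) by blast
qed fact+

lemma poly_S2n_gens [simp]: "coord_a i \<in> poly_S2n" "cnj \<circ> coord_a i \<in> poly_S2n" "coord_t \<in> poly_S2n"
  by (auto simp: poly_S2n_def intro: poly_funs.gen poly_funs.gen_cnj)

lemmas poly_S2n_intros =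
  poly_funs.add[where X = S2n and G = "range coord_a \<union> {coord_t}", folded poly_S2n_def]
  poly_funs.mult[where X = S2n and G = "range coord_a \<union> {coord_t}", folded poly_S2n_def]
  poly_funs.const[where X = S2n and G = "range coord_a \<union> {coord_t}", folded poly_S2n_def]
  poly_funs_diff[where X = S2n and G = "range coord_a \<union> {coord_t}", folded poly_S2n_def]
  poly_funs_power[where X = S2n and G = "range coord_a \<union> {coord_t}", folded poly_S2n_def]
  poly_funs_sum[where X = S2n and G = "range coord_a \<union> {coord_t}", folded poly_S2n_def]

text \<open>
  The left side is \<open>weight p {..<k}\<close>, and the sum telescopes to its difference from \<open>t\<^sup>2\<close>.
\<close>

lemma tau_sq_monomial:
  assumes p: "p \<in> S2_prod_pos"
  shows "(tau k p)\<^sup>2 * (sqrt_tau_monomial (twice_M k) p)\<^sup>2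
    = (coord_t (Phi p))\<^sup>2 + (\<Sum>l | l < k. coord_a l (Phi p) * cnj (coord_a l (Phi p)))"
proof -
  have S2: "p \<in> S2_prod" using p by (simp add: S2_prod_pos_def)
  have "(sqrt_tau_monomial (twice_M k) p)\<^sup>2 = (\<Prod>j\<in>UNIV. tau j p ^ twice_M k j)"
    unfolding sqrt_tau_monomial_def prod_power_distrib
    using sqrt_tau_sq[OF p] by (intro prod.cong) (simp_all add: power2_eq_square power_mult_distrib)
  then have "(tau k p)\<^sup>2 * (sqrt_tau_monomial (twice_M k) p)\<^sup>2 = of_real (weight p {..<k})"
    by (simp add: weight_lessThan tau_def)
  also have "weight p {..<k} = (snd (Phi p))\<^sup>2 + (\<Sum>l\<in>{..<k}. (cmod (fst (Phi p) $ l))\<^sup>2)"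
    using sum_cmod_Phi_sq[OF S2, of "{..<k}"] by simp
  also have "of_real \<dots> = (coord_t (Phi p))\<^sup>2
      + (\<Sum>l | l < k. coord_a l (Phi p) * cnj (coord_a l (Phi p)))"
    by (simp add: coord_t_def coord_a_def complex_norm_square[symmetric] lessThan_def)
  finally show ?thesis .
qed

context
  fixes B :: "(('n::{finite,linorder}) S2_prod_space \<Rightarrow> complex) \<Rightarrow>
      ('n S2_prod_space \<Rightarrow> complex) \<Rightarrow> ('n S2_prod_space \<Rightarrow> complex)"
  assumes B: "standard_product_bracket B"
begin

interpretation standard_product_bracket B by (rule B)

lemma pulled_bracket_cong:
  assumes p: "p \<in> S2_prod_pos"
    and "u \<in> half_poly_S2_prod" "v \<in> half_poly_S2_prod" "f \<in> poly_S2n" "g \<in> poly_S2n"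
    and "\<And>q. q \<in> S2_prod_pos \<Longrightarrow> (f \<circ> Phi) q = u q" "\<And>q. q \<in> S2_prod_pos \<Longrightarrow> (g \<circ> Phi) q = v q"
  shows "B (f \<circ> Phi) (g \<circ> Phi) p = B u v p"
  by (rule respects_both) (use assms in \<open>simp_all add: poly_S2n_comp_Phi del: o_apply\<close>)

lemma cnj_coord_a_Phi:
  assumes "q \<in> S2_prod_pos"
  shows "((cnj \<circ> coord_a k) \<circ> Phi) q = (cnj \<circ> alpha_monomial k (twice_M k)) q"
  using coord_a_Phi[OF assms, of k] by simp

lemma pulled_a_a:
  assumes p: "p \<in> S2_prod_pos" and "k < l"
  shows "B (coord_a k \<circ> Phi) (coord_a l \<circ> Phi) p = coord_a k (Phi p) * coord_a l (Phi p)"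
proof -
  have "B (coord_a k \<circ> Phi) (coord_a l \<circ> Phi) p
      = B (alpha_monomial k (twice_M k)) (alpha_monomial l (twice_M l)) p"
    by (intro pulled_bracket_cong p alpha_monomial_mem poly_S2n_gens coord_a_Phi)
  also have "\<dots> = (coord_a k \<circ> Phi) p * (coord_a l \<circ> Phi) p"
    using assms by (auto simp: alpha_monomials coord_a_Phi twice_M_def simp del: o_apply)
  finally show ?thesis by simp
qed

lemma pulled_a_cnj_a:
  assumes p: "p \<in> S2_prod_pos" and "k \<noteq> l"
  shows "B (coord_a k \<circ> Phi) ((cnj \<circ> coord_a l) \<circ> Phi) p
    = - 3 * coord_a k (Phi p) * cnj (coord_a l (Phi p))"
proof -
  have "B (coord_a k \<circ> Phi) ((cnj \<circ> coord_a l) \<circ> Phi) p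
      = B (alpha_monomial k (twice_M k)) (cnj \<circ> alpha_monomial l (twice_M l)) p"
    by (intro pulled_bracket_cong p alpha_monomial_mem half_poly_cnj poly_S2n_gens coord_a_Phi
        cnj_coord_a_Phi)
  also have "\<dots> = - 3 * (coord_a k \<circ> Phi) p * cnj ((coord_a l \<circ> Phi) p)"
    using assms by (auto simp: alpha_monomial_cnj coord_a_Phi twice_M_def simp del: o_apply)
  finally show ?thesis by simp
qed

lemma pulled_a_t:
  assumes p: "p \<in> S2_prod_pos"
  shows "B (coord_a k \<circ> Phi) (coord_t \<circ> Phi) p = - 2 * coord_a k (Phi p) * coord_t (Phi p)"
proof -
  have "B (coord_a k \<circ> Phi) (coord_t \<circ> Phi) p
      = B (alpha_monomial k (twice_M k)) (sqrt_tau_monomial (\<lambda>_. 2)) p"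
    by (intro pulled_bracket_cong p alpha_monomial_mem sqrt_tau_monomial_mem poly_S2n_gens
        coord_a_Phi coord_t_Phi)
  also have "\<dots> = - 2 * (coord_a k \<circ> Phi) p * (coord_t \<circ> Phi) p"
    using assms
    by (simp add: alpha_monomial_sqrt_tau_monomial coord_a_Phi coord_t_Phi del: o_apply)
  finally show ?thesis by simp
qed

lemma pulled_a_cnj_a_same:
  assumes p: "p \<in> S2_prod_pos"
  shows "B (coord_a k \<circ> Phi) ((cnj \<circ> coord_a k) \<circ> Phi) p
    = 2 * (coord_t (Phi p))\<^sup>2 + 2 * (\<Sum>l | l < k. coord_a l (Phi p) * cnj (coord_a l (Phi p)))
      - 2 * coord_a k (Phi p) * cnj (coord_a k (Phi p))"
proof -
  let ?a = "alpha_monomial k (twice_M k)"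
  have "B (coord_a k \<circ> Phi) ((cnj \<circ> coord_a k) \<circ> Phi) p = B ?a (cnj \<circ> ?a) p"
    by (intro pulled_bracket_cong p alpha_monomial_mem half_poly_cnj poly_S2n_gens coord_a_Phi
        cnj_coord_a_Phi)
  also have "\<dots> = 2 * ((tau k p)\<^sup>2 * (sqrt_tau_monomial (twice_M k) p)\<^sup>2 - ?a p * cnj (?a p))"
    by (intro alpha_monomial_cnj_self p) (simp add: twice_M_def)
  also have "\<dots> = 2 * ((tau k p)\<^sup>2 * (sqrt_tau_monomial (twice_M k) p)\<^sup>2
      - coord_a k (Phi p) * cnj (coord_a k (Phi p)))"
    using coord_a_Phi[OF p, of k] by simp
  finally show ?thesis unfolding tau_sq_monomial[OF p] by (simp only: algebra_simps)
qed

lemma bracket_gens_descend: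
  assumes "f \<in> range coord_a \<union> {coord_t}" "g \<in> range coord_a \<union> {coord_t}"
  shows "\<exists>h\<in>poly_S2n. \<forall>p\<in>S2_prod_pos. B (f \<circ> Phi) (g \<circ> Phi) p = h (Phi p)"
    and "\<exists>h\<in>poly_S2n. \<forall>p\<in>S2_prod_pos. B (f \<circ> Phi) ((cnj \<circ> g) \<circ> Phi) p = h (Phi p)"
proof -
  let ?descends = "\<lambda>f g. \<exists>h\<in>poly_S2n. \<forall>p\<in>S2_prod_pos. B (f \<circ> Phi) (g \<circ> Phi) p = h (Phi p)"
  have swap: "?descends g f" if "?descends f g" "f \<in> poly_S2n" "g \<in> poly_S2n"
    for f g :: "'n S2n_space \<Rightarrow> complex"
  proof -
    from that(1) obtain h where h: "h \<in> poly_S2n" "\<forall>p\<in>S2_prod_pos. B (f \<circ> Phi) (g \<circ> Phi) p = h (Phi p)"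
      by blast
    have "B (g \<circ> Phi) (f \<circ> Phi) p = 0 - h (Phi p)" if "p \<in> S2_prod_pos" for p
      using antisym[OF poly_S2n_comp_Phi poly_S2n_comp_Phi, of g f p] h(2) that
        \<open>f \<in> poly_S2n\<close> \<open>g \<in> poly_S2n\<close> by simp
    then show ?thesis using h(1)
      by (intro bexI[of _ "\<lambda>x. 0 - h x"] poly_S2n_intros(3,4)) blast
  qed
  have self: "?descends f f" if "f \<in> poly_S2n" for f :: "'n S2n_space \<Rightarrow> complex"
    using self_zero[OF poly_S2n_comp_Phi[OF that]]
    by (intro bexI[of _ "\<lambda>_. 0"] poly_S2n_intros(3)) blast
  have less: "?descends (coord_a k) (coord_a l)" if "k < l" for k l :: 'n
    using pulled_a_a[OF _ that]
    by (intro bexI[of _ "\<lambda>x. coord_a k x * coord_a l x"] poly_S2n_intros(2) poly_S2n_gens) blast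
  have aa: "?descends (coord_a k) (coord_a l)" for k l :: 'n
    by (cases k l rule: linorder_cases) (use less swap self in simp_all)
  have at: "?descends (coord_a k) coord_t" for k :: 'n
    using pulled_a_t
    by (intro bexI[of _ "\<lambda>x. - 2 * coord_a k x * coord_t x"] poly_S2n_intros(2,3) poly_S2n_gens) blast
  have ac: "?descends (coord_a k) (cnj \<circ> coord_a l)" for k l :: 'n
  proof (cases "k = l")
    case False
    then show ?thesis using pulled_a_cnj_a
      by (intro bexI[of _ "\<lambda>x. - 3 * coord_a k x * (cnj \<circ> coord_a l) x"] poly_S2n_intros(2,3) poly_S2n_gens)
        simp_all
  next
    case True
    have "(\<lambda>x. 2 * (coord_t x)\<^sup>2 + 2 * (\<Sum>l\<in>{l. l < k}. coord_a l x * (cnj \<circ> coord_a l) x)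
        - 2 * coord_a k x * (cnj \<circ> coord_a k) x) \<in> poly_S2n"
      by (intro poly_S2n_intros poly_S2n_gens) simp
    with True show ?thesis using pulled_a_cnj_a_same[of _ k] by fastforce
  qed
  have c: "cnj \<circ> coord_t = (coord_t :: 'n S2n_space \<Rightarrow> complex)" by (simp add: coord_t_def fun_eq_iff)
  have ta: "?descends coord_t (coord_a k)" for k :: 'n using swap[OF at] by simp
  have "?descends (cnj \<circ> coord_t) (cnj \<circ> coord_a k)" for k :: 'n
  proof -
    obtain h where h: "h \<in> poly_S2n" "\<forall>p\<in>S2_prod_pos. B (coord_t \<circ> Phi) (coord_a k \<circ> Phi) p = h (Phi p)"
      using ta by blast
    then have "B ((cnj \<circ> coord_t) \<circ> Phi) ((cnj \<circ> coord_a k) \<circ> Phi) p = 0 - (cnj \<circ> h) (Phi p)"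
      if "p \<in> S2_prod_pos" for p
      using that reality[OF poly_S2n_comp_Phi poly_S2n_comp_Phi, of coord_t "coord_a k" p]
      unfolding comp_assoc by simp
    moreover have "cnj \<circ> h \<in> poly_S2n" using poly_funs_cnj h(1) unfolding poly_S2n_def .
    ultimately show ?thesis
      by (intro bexI[of _ "\<lambda>x. 0 - (cnj \<circ> h) x"] poly_S2n_intros(3,4)) blast
  qed
  then have tc: "?descends coord_t (cnj \<circ> coord_a k)" for k :: 'n unfolding c .
  show "?descends f g" using assms aa at ta self[OF poly_S2n_gens(3)] by blast
  show "?descends f (cnj \<circ> g)"
    using assms ac at tc self[OF poly_S2n_gens(3)] c by fastforce
qed

lemma poisson_map_Phi: "poisson_map Phi B"
proof -
  have "\<exists>C. poisson_bracket S2n poly_S2n C \<and>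
      (\<forall>f\<in>poly_S2n. \<forall>g\<in>poly_S2n. \<forall>p\<in>S2_prod_pos. B (f \<circ> Phi) (g \<circ> Phi) p = C f g (Phi p))"
    unfolding poly_S2n_def
  proof (rule coinduced_exists, unfold poly_S2n_def[symmetric])
    show "Phi ` S2_prod_pos \<subseteq> S2n" using Phi_mem_pos by blast
    show "f x = g x" if "f \<in> poly_S2n" "g \<in> poly_S2n"
      "\<And>p. p \<in> S2_prod_pos \<Longrightarrow> f (Phi p) = g (Phi p)" "x \<in> S2n" for f g and x :: "'n S2n_space"
      using poly_S2n_determined_by_Phi[OF that(1,2,4,3)] .
  qed (simp_all only: poly_S2n_comp_Phi bracket_gens_descend)
  then show ?thesis
    unfolding poisson_map_def coinduced_bracket_def using Phi_mem poly_S2n_comp_Phi by blast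
qed

text \<open>
  A coinduced bracket takes polynomial values, so its values at the origin, which \<open>\<Phi>\<close> does not
  reach from \<open>S2_prod_pos\<close>, are also determined by \<open>B\<close>.
\<close>

lemma coinduced_bracket_eqI:
  assumes C: "coinduced_bracket Phi B C"
    and "f \<in> poly_S2n" "g \<in> poly_S2n" "h \<in> poly_S2n" "x \<in> S2n"
    and "\<And>p. p \<in> S2_prod_pos \<Longrightarrow> B (f \<circ> Phi) (g \<circ> Phi) p = h (Phi p)"
  shows "C f g x = h x"
proof (rule poly_S2n_determined_by_Phi)
  show "C f g \<in> poly_S2n"
    using C assms(2,3) poisson_bracket.closed unfolding coinduced_bracket_def by blast
  show "C f g (Phi p) = h (Phi p)" if "p \<in> S2_prod_pos" for p
    using C assms(2,3,6) that unfolding coinduced_bracket_def by metis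
qed fact+

end

theorem proposition1:
  fixes B :: "(('n::{finite,linorder}) S2_prod_space \<Rightarrow> complex) \<Rightarrow>
      ('n S2_prod_space \<Rightarrow> complex) \<Rightarrow> ('n S2_prod_space \<Rightarrow> complex)"
  assumes "standard_product_bracket B"
  shows "poisson_map Phi B \<and>
    (\<forall>C. coinduced_bracket Phi B C \<longrightarrow>
      (\<forall>x\<in>S2n.
        (\<forall>k l. k < l \<longrightarrow>
          C (coord_a k) (coord_a l) x = coord_a k x * coord_a l x) \<and>
        (\<forall>k l. k \<noteq> l \<longrightarrow>
          C (coord_a k) (cnj \<circ> coord_a l) x = - 3 * coord_a k x * cnj (coord_a l x)) \<and>
        (\<forall>i. C (coord_a i) coord_t x = - 2 * coord_a i x * coord_t x) \<and>
        (\<forall>k. C (coord_a k) (cnj \<circ> coord_a k) x =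
          2 * (coord_t x)\<^sup>2 + 2 * (\<Sum>l | l < k. coord_a l x * cnj (coord_a l x))
            - 2 * coord_a k x * cnj (coord_a k x))))"
proof (intro conjI allI impI ballI)
  show "poisson_map Phi B" by (rule poisson_map_Phi[OF assms])
next
  fix C and x :: "'n S2n_space" and k l :: 'n
  assume C: "coinduced_bracket Phi B C" and x: "x \<in> S2n"
  have cnj_a: "(\<lambda>x. cnj (coord_a l x)) \<in> poly_S2n" for l :: 'n
    using poly_S2n_gens(2)[of l] by (simp only: o_def)
  note mem = poly_S2n_intros poly_S2n_gens cnj_a
  note eqI = coinduced_bracket_eqI[OF assms C _ _ _ x]
  show "C (coord_a k) (coord_a l) x = coord_a k x * coord_a l x" if "k < l"
    by (rule eqI[where h = "\<lambda>x. coord_a k x * coord_a l x"])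
       (intro mem pulled_a_a[OF assms] that; assumption)+
  show "C (coord_a k) (cnj \<circ> coord_a l) x = - 3 * coord_a k x * cnj (coord_a l x)" if "k \<noteq> l"
    by (rule eqI[where h = "\<lambda>x. - 3 * coord_a k x * cnj (coord_a l x)"])
       (intro mem pulled_a_cnj_a[OF assms] that; assumption)+
  show "C (coord_a k) coord_t x = - 2 * coord_a k x * coord_t x"
    by (rule eqI[where h = "\<lambda>x. - 2 * coord_a k x * coord_t x"])
       (intro mem pulled_a_t[OF assms]; assumption)+
  show "C (coord_a k) (cnj \<circ> coord_a k) x =
      2 * (coord_t x)\<^sup>2 + 2 * (\<Sum>l | l < k. coord_a l x * cnj (coord_a l x))
        - 2 * coord_a k x * cnj (coord_a k x)"
    by (rule eqI[where h = "\<lambda>x. 2 * (coord_t x)\<^sup>2 + 2 * (\<Sum>l | l < k. coord_a l x * cnj (coord_a l x))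
          - 2 * coord_a k x * cnj (coord_a k x)"])
       ((intro mem pulled_a_cnj_a_same[OF assms]; (assumption | simp))+)
qed

end
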